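(* Let $D^-$ be the additive code defined in the context and let $D^{3-}$ be any code of length $9$ obtained from $D^-$ by puncturing any two of its coordinates. Then the coset graph $\Gamma_{D^{3-}}$ is strongly regular with parameters $(64,27,10,12)$, and its spectrum is $\{27^1,3^{36},(-5)^{27}\}$ (exponents are multiplicities).
   Context: $\mathbb{F}_4=\{0,1,\omega,\omega^2\}$ with $\omega^2=\omega+1$. Puncturing means projecting onto the remaining coordinates. The coset graph $\Gamma_C$ of an additive code $C\subseteq\mathbb{F}_4^n$ (additive subgroup) has as vertices the cosets $x+C$, two cosets adjacent if their difference contains a vector of Hamming weight $1$. Strongly regular parameters $(\nu,\kappa,\lambda,\mu)$: vertices, degree, common neighbours of adjacent pairs, of non-adjacent pairs. $D^-$ is the $\mathbb{F}_2$-span of the following $12$ vectors of $\mathbb{F}_4^{11}$: $(0,0,0,0,0,\omega^2,\omega^2,0,\omega,1,\omega)$, $(0,0,0,0,0,\omega,0,\omega,\omega,\omega,1)$, $(1,0,0,0,0,1,0,1,\omega^2,\omega^2,1)$, $(\omega,0,0,0,0,0,\omega,1,\omega,\omega,\omega)$, $(0,1,0,0,0,0,1,1,1,\omega^2,\omega^2)$, $(0,\omega,0,0,0,\omega^2,1,\omega^2,\omega,\omega,0)$, $(0,0,1,0,0,\omega,\omega,1,1,0,1)$, $(0,0,\omega,0,0,\omega,1,\omega,\omega^2,\omega^2,0)$, $(0,0,0,1,0,\omega,\omega,\omega,0,1,\omega)$, $(0,0,0,\omega,0,\omega^2,1,1,\omega^2,0,\omega)$, $(0,0,0,0,1,\omega^2,\omega^2,\omega^2,1,0,\omega^2)$,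 $(0,0,0,0,\omega,\omega,1,0,1,\omega,\omega)$. *)

theory Defs
  imports
    "Graph_Theory.Pair_Digraph"
    "Jordan_Normal_Form.Char_Poly"
begin

datatype f4 = F4_zero | F4_one | W | W2

instantiation f4 :: field
begin

definition zero_f4 :: f4 where "0 = F4_zero"

definition one_f4 :: f4 where "1 = F4_one"

fun plus_f4 :: "f4 \<Rightarrow> f4 \<Rightarrow> f4" where
  "F4_zero + y = y"
| "F4_one + y = (case y of F4_zero \<Rightarrow> F4_one | F4_one \<Rightarrow> F4_zero | W \<Rightarrow> W2 | W2 \<Rightarrow> W)"
| "W + y = (case y of F4_zero \<Rightarrow> W | F4_one \<Rightarrow> W2 | W \<Rightarrow> F4_zero | W2 \<Rightarrow> F4_one)"
| "W2 + y = (case y of F4_zero \<Rightarrow> W2 | F4_one \<Rightarrow> W | W \<Rightarrow> F4_one | W2 \<Rightarrow> F4_zero)"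

definition uminus_f4 :: "f4 \<Rightarrow> f4" where "- x = (x :: f4)"

definition minus_f4 :: "f4 \<Rightarrow> f4 \<Rightarrow> f4" where "x - y = x + (y :: f4)"

fun times_f4 :: "f4 \<Rightarrow> f4 \<Rightarrow> f4" where
  "F4_zero * y = F4_zero"
| "F4_one * y = y"
| "W * y = (case y of F4_zero \<Rightarrow> F4_zero | F4_one \<Rightarrow> W | W \<Rightarrow> W2 | W2 \<Rightarrow> F4_one)"
| "W2 * y = (case y of F4_zero \<Rightarrow> F4_zero | F4_one \<Rightarrow> W2 | W \<Rightarrow> F4_one | W2 \<Rightarrow> W)"

fun inverse_f4 :: "f4 \<Rightarrow> f4" where
  "inverse F4_zero = F4_zero"
| "inverse F4_one = F4_one"
| "inverse W = W2"
| "inverse W2 = W"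

definition divide_f4 :: "f4 \<Rightarrow> f4 \<Rightarrow> f4" where "x div y = x * inverse (y :: f4)"

instance
proof
  fix a b c :: f4
  show "a * b * c = a * (b * c)" by (cases a; cases b; cases c; simp)
  show "a * b = b * a" by (cases a; cases b; simp)
  show "1 * a = a" by (simp add: one_f4_def)
  show "a + b + c = a + (b + c)" by (cases a; cases b; cases c; simp)
  show "a + b = b + a" by (cases a; cases b; simp)
  show "0 + a = a" by (simp add: zero_f4_def)
  show "- a + a = 0" by (cases a; simp add: uminus_f4_def zero_f4_def)
  show "a - b = a + - b" by (simp add: minus_f4_def uminus_f4_def)
  show "(a + b) * c = a * c + b * c" by (cases a; cases b; cases c; simp)
  show "(0 :: f4) \<noteq> 1" by (simp add: zero_f4_def one_f4_def)
  show "a \<noteq> 0 \<Longrightarrow> inverse a * a = 1" by (cases a; simp add: zero_f4_def one_f4_def)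
  show "a div b = a * inverse b" by (simp add: divide_f4_def)
  show "inverse (0 :: f4) = 0" by (simp add: zero_f4_def)
qed

end

lemma UNIV_f4: "UNIV = {0, 1, W, W2}"
  by (auto simp: zero_f4_def one_f4_def intro: f4.exhaust)

lemma W_squared: "W\<^sup>2 = W2" "W2 = W + 1"
  by (simp_all add: power2_eq_square one_f4_def)

text \<open>Vectors of \<open>\<bbbF>\<^sub>4\<^sup>n\<close> are the elements of \<^term>\<open>carrier_vec n :: f4 vec set\<close>, so
  coordinates are numbered from \<open>0\<close>. The scalar field \<open>\<bbbF>\<^sub>2\<close> is the prime subfield
  \<^term>\<open>{0, 1 :: f4}\<close>.\<close>

definition f2_span :: "nat \<Rightarrow> f4 vec list \<Rightarrow> f4 vec set" where
  "f2_span n gs =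
     {finsum_vec TYPE(f4) n (\<lambda>i. a i \<cdot>\<^sub>v gs ! i) {..<length gs} | a. range a \<subseteq> {0, 1}}"

definition D_minus :: "f4 vec set" where
  "D_minus = f2_span 11 (map vec_of_list
    [[0,0,0,0,0,W2,W2,0,W,1,W],
     [0,0,0,0,0,W,0,W,W,W,1],
     [1,0,0,0,0,1,0,1,W2,W2,1],
     [W,0,0,0,0,0,W,1,W,W,W],
     [0,1,0,0,0,0,1,1,1,W2,W2],
     [0,W,0,0,0,W2,1,W2,W,W,0],
     [0,0,1,0,0,W,W,1,1,0,1],
     [0,0,W,0,0,W,1,W,W2,W2,0],
     [0,0,0,1,0,W,W,W,0,1,W],
     [0,0,0,W,0,W2,1,1,W2,0,W],
     [0,0,0,0,1,W2,W2,W2,1,0,W2],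
     [0,0,0,0,W,W,1,0,1,W,W]])"

text \<open>\<open>puncture P\<close> deletes the coordinates in \<open>P\<close> and keeps the others in their order.\<close>

definition puncture :: "nat set \<Rightarrow> 'a vec \<Rightarrow> 'a vec" where
  "puncture P v = vec_of_list (nths (list_of_vec v) (- P))"

definition hamming_weight :: "'a :: zero vec \<Rightarrow> nat" where
  "hamming_weight v = card {i. i < dim_vec v \<and> v $ i \<noteq> 0}"

definition cosets :: "nat \<Rightarrow> f4 vec set \<Rightarrow> f4 vec set set" where
  "cosets n C = {(\<lambda>c. x + c) ` C | x. x \<in> carrier_vec n}"

text \<open>A loop at every vertex is not excluded by definition: it arises when \<open>C\<close> itself contains
  a vector of weight 1. Strong regularity below requires a loopless graph.\<close>

definition coset_graph :: "nat \<Rightarrow> f4 vec set \<Rightarrow> f4 vec set pair_pre_digraph" where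
  "coset_graph n C =
     \<lparr> pverts = cosets n C,
       parcs = {(X, Y). X \<in> cosets n C \<and> Y \<in> cosets n C \<and>
                        (\<exists>x\<in>X. \<exists>y\<in>Y. hamming_weight (x - y) = 1)} \<rparr>"

text \<open>The locale predicate \<^const>\<open>pair_graph\<close> says finite, symmetric and loopless.\<close>

definition strongly_regular ::
  "'a pair_pre_digraph \<Rightarrow> nat \<Rightarrow> nat \<Rightarrow> nat \<Rightarrow> nat \<Rightarrow> bool" where
  "strongly_regular G \<nu> \<kappa> l \<mu> \<longleftrightarrow>
     pair_graph G \<and>
     card (pverts G) = \<nu> \<and>
     (\<forall>u \<in> pverts G. card {w \<in> pverts G. (u, w) \<in> parcs G} = \<kappa>) \<and>
     (\<forall>u \<in> pverts G. \<forall>v \<in> pverts G. u \<noteq> v \<longrightarrow>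
        card {w \<in> pverts G. (u, w) \<in> parcs G \<and> (v, w) \<in> parcs G} =
          (if (u, v) \<in> parcs G then l else \<mu>))"

definition adjacency_matrix :: "'a pair_pre_digraph \<Rightarrow> 'a list \<Rightarrow> real mat" where
  "adjacency_matrix G vs =
     mat (length vs) (length vs) (\<lambda>(i, j). if (vs ! i, vs ! j) \<in> parcs G then 1 else 0)"

text \<open>\<open>M\<close> is the multiset of eigenvalues of the adjacency matrix, for any ordering \<open>vs\<close> of the
  vertices; \<^const>\<open>proots\<close> counts the roots of the characteristic polynomial with multiplicity.\<close>

definition has_spectrum :: "'a pair_pre_digraph \<Rightarrow> real multiset \<Rightarrow> bool" where
  "has_spectrum G M \<longleftrightarrow>
     finite (pverts G) \<and>
     (\<forall>vs. distinct vs \<and> set vs = pverts G \<longrightarrow>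
        proots (char_poly (adjacency_matrix G vs)) = M)"

end

theory Submission
  imports Defs
begin

text \<open>
  Prefixing the generators of \<open>D\<^sup>-\<close> with one coordinate \<open>(1, \<omega>, 0, \<dots>, 0)\<close> yields generators
  of the dodecacode, an additive code of length 12 that is self-dual for the trace-Hermitian form
  and whose nonzero weights are 6, 8, 10 and 12. Hence the punctured code \<open>C\<close> of length 9 has
  \<open>4096\<close> words and minimum distance at least 3, and its dual consists of the words of the
  dodecacode that vanish on the three deleted coordinates: 64 words of weight 0, 6 or 8.

  The coset graph is a Cayley graph of \<open>\<bbbF>\<^sub>4\<^sup>9 / C\<close> whose characters are the words \<open>u\<close> of the dual
  code, and its eigenvalue at \<open>u\<close> is \<open>27 - 4 wt u\<close>. Fourier inversion turns the quadratic equation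
  \<open>(\<theta> - 3) (\<theta> + 5) = 0\<close> for the nontrivial eigenvalues into the counts of common neighbours, and
  trace zero fixes the multiplicities.
\<close>

section \<open>Characters\<close>

lemma f4_add_self [simp]: "(x :: f4) + x = 0"
  by (cases x) (simp_all add: zero_f4_def)

lemma f4_vec_add_self: "x \<in> carrier_vec n \<Longrightarrow> x + x = (0\<^sub>v n :: f4 vec)"
  by (rule eq_vecI) auto

lemma f4_vec_add_add_cancel:
  "x \<in> carrier_vec n \<Longrightarrow> y \<in> carrier_vec n \<Longrightarrow> x + (x + y) = (y :: f4 vec)"
  by (rule eq_vecI) (auto simp flip: add.assoc)

lemma f4_vec_add_add_add_cancel:
  assumes "x \<in> carrier_vec n" "y \<in> carrier_vec n" "z \<in> carrier_vec n"
  shows "(x + y) + (x + z) = (y + z :: f4 vec)"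
proof -
  have "(x + y) + (x + z) = (x + x) + (y + z)"
    using assms by (intro eq_vecI) (auto simp: ac_simps simp del: f4_add_self)
  thus ?thesis using assms by (simp add: f4_vec_add_self)
qed

lemma f4_vec_minus_eq_add: "x - y = x + (y :: f4 vec)"
  by (rule eq_vecI) (auto simp: minus_f4_def)

lemma f4_vec_add_eq_zero_iff:
  "x \<in> carrier_vec n \<Longrightarrow> y \<in> carrier_vec n \<Longrightarrow> x + y = 0\<^sub>v n \<longleftrightarrow> x = (y :: f4 vec)"
  by (metis f4_vec_add_add_cancel f4_vec_add_self right_zero_vec)

lemma carrier_vec_conv_lists: "carrier_vec n = vec_of_list ` {xs. length xs = n}"
proof -
  have "x \<in> vec_of_list ` {xs. length xs = n}" if "x \<in> carrier_vec n" for x :: "'a vec"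
    using that by (intro image_eqI[of _ _ "list_of_vec x"]) (auto simp: vec_list)
  moreover have "vec_of_list xs \<in> carrier_vec (length xs)" for xs :: "'a list"
    by (rule carrier_vecI) simp
  ultimately show ?thesis by blast
qed

lemma finite_f4: "finite (UNIV :: f4 set)"
  by (simp add: UNIV_f4)

lemma card_f4: "card (UNIV :: f4 set) = 4"
  by (simp add: UNIV_f4 zero_f4_def one_f4_def)

lemma finite_carrier_vec_f4 [simp]: "finite (carrier_vec n :: f4 vec set)"
  using finite_lists_length_eq[OF finite_f4, of n] by (simp add: carrier_vec_conv_lists)

lemma card_carrier_vec_f4: "card (carrier_vec n :: f4 vec set) = 4 ^ n"
proof -
  have "inj_on vec_of_list {xs :: f4 list. length xs = n}"
    by (metis inj_onI list_vec)
  thus ?thesis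
    using card_lists_length_eq[OF finite_f4, of n]
    by (simp add: carrier_vec_conv_lists card_image card_f4)
qed

text \<open>The trace-Hermitian form \<open>x y\<^sup>2 + x\<^sup>2 y\<close> on \<open>\<bbbF>\<^sub>4\<close>, as a sign: it vanishes exactly
  when one argument is zero or both agree.\<close>

definition f4_char :: "f4 \<Rightarrow> f4 \<Rightarrow> real" where
  "f4_char a b = (if a = 0 \<or> b = 0 \<or> a = b then 1 else -1)"

lemma f4_char_commute: "f4_char a b = f4_char b a"
  by (auto simp: f4_char_def)

text \<open>The underlying form is additive in each argument, which its case formula hides; all 64
  triples are checked.\<close>

lemma f4_char_add: "f4_char a (b + c) = f4_char a b * f4_char a c"
  by (cases a; cases b; cases c; simp add: f4_char_def zero_f4_def)

text \<open>The sign of the trace-Hermitian inner product of \<open>u\<close> and \<open>x\<close>;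
  since the form is nondegenerate, every character of the additive group of vectors of length
  \<open>n\<close> is some \<open>chi u\<close>.\<close>

definition chi :: "f4 vec \<Rightarrow> f4 vec \<Rightarrow> real" where
  "chi u x = (\<Prod>i<dim_vec x. f4_char (u $ i) (x $ i))"

lemma chi_commute: "u \<in> carrier_vec n \<Longrightarrow> x \<in> carrier_vec n \<Longrightarrow> chi u x = chi x u"
  by (simp add: chi_def f4_char_commute)

lemma chi_add:
  "x \<in> carrier_vec n \<Longrightarrow> y \<in> carrier_vec n \<Longrightarrow> chi u (x + y) = chi u x * chi u y"
  by (simp add: chi_def f4_char_add prod.distrib)

lemma chi_add_left:
  "u \<in> carrier_vec n \<Longrightarrow> v \<in> carrier_vec n \<Longrightarrow> x \<in> carrier_vec n \<Longrightarrow>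
   chi (u + v) x = chi u x * chi v x"
  by (metis add_carrier_vec chi_add chi_commute)

lemma chi_zero [simp]: "chi u (0\<^sub>v n) = 1"
  by (simp add: chi_def f4_char_def)

lemma chi_zero_left [simp]: "x \<in> carrier_vec n \<Longrightarrow> chi (0\<^sub>v n) x = 1"
  by (auto simp: chi_def f4_char_def)

lemma chi_cases: "chi u x = 1 \<or> chi u x = -1"
proof -
  have "(\<Prod>i\<in>I. f4_char (u $ i) (x $ i)) \<in> {1, -1}" for I
    by (induction I rule: infinite_finite_induct) (auto simp: f4_char_def)
  thus ?thesis by (simp add: chi_def)
qed

lemma chi_square: "chi u x * chi u x = 1"
  using chi_cases[of u x] by auto

definition single_vec :: "nat \<Rightarrow> nat \<Rightarrow> f4 \<Rightarrow> f4 vec" where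
  "single_vec n i a = vec n (\<lambda>j. if j = i then a else 0)"

lemma single_vec_carrier [simp]: "single_vec n i a \<in> carrier_vec n"
  by (simp add: single_vec_def)

lemma chi_single_vec: "i < n \<Longrightarrow> chi u (single_vec n i a) = f4_char (u $ i) a"
proof -
  assume i: "i < n"
  have "chi u (single_vec n i a) = (\<Prod>j<n. if j = i then f4_char (u $ i) a else 1)"
    unfolding chi_def by (rule prod.cong) (auto simp: single_vec_def f4_char_def)
  thus ?thesis using i by simp
qed

text \<open>Nondegeneracy: at a nonzero coordinate of \<open>u\<close>, a vector supported there
  alone already gives the sign -1.\<close>

lemma ex_chi_neq_1:
  assumes u: "u \<in> carrier_vec n" "u \<noteq> 0\<^sub>v n"
  shows "\<exists>x \<in> carrier_vec n. chi u x \<noteq> 1"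
proof -
  obtain i where i: "i < n" "u $ i \<noteq> 0"
    using u by (metis carrier_vecD eq_vecI index_zero_vec)
  \<comment> \<open>The sign is -1 exactly when \<open>a\<close> is nonzero and differs from
    \<open>b\<close>.\<close>
  have "\<exists>a. f4_char b a \<noteq> 1" if "b \<noteq> 0" for b
  proof (cases b)
    case W thus ?thesis by (intro exI[of _ W2]) (simp add: f4_char_def zero_f4_def)
  next
    case W2 thus ?thesis by (intro exI[of _ W]) (simp add: f4_char_def zero_f4_def)
  qed (use that in \<open>auto simp: f4_char_def zero_f4_def intro: exI[of _ W]\<close>)
  then obtain a where "f4_char (u $ i) a \<noteq> 1" using i by blast
  thus ?thesis using i by (intro bexI[of _ "single_vec n i a"]) (auto simp: chi_single_vec)
qed

section \<open>Duality of additive codes\<close>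

definition dual_code :: "nat \<Rightarrow> f4 vec set \<Rightarrow> f4 vec set" where
  "dual_code n C = {u \<in> carrier_vec n. \<forall>c\<in>C. chi u c = 1}"

text \<open>Closure under addition gives a subgroup, because every vector is its own
  negative.\<close>

locale additive_code =
  fixes n :: nat and C :: "f4 vec set"
  assumes subset_carrier: "C \<subseteq> carrier_vec n"
    and zero_mem [simp]: "0\<^sub>v n \<in> C"
    and add_mem: "x \<in> C \<Longrightarrow> y \<in> C \<Longrightarrow> x + y \<in> C"

lemma additive_dual_code:
  assumes "S \<subseteq> carrier_vec n"
  shows "additive_code n (dual_code n S)"
proof
  fix u v assume "u \<in> dual_code n S" "v \<in> dual_code n S"
  thus "u + v \<in> dual_code n S"
    using assms by (auto simp: dual_code_def chi_add_left[of u n v])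
qed (use assms in \<open>auto simp: dual_code_def\<close>)

lemma additive_code_carrier_vec: "additive_code n (carrier_vec n)"
  by unfold_locales auto

lemma dual_carrier_vec: "dual_code n (carrier_vec n) = {0\<^sub>v n}"
  using ex_chi_neq_1 by (fastforce simp: dual_code_def)

context additive_code
begin

lemma mem_carrier: "x \<in> C \<Longrightarrow> x \<in> carrier_vec n"
  using subset_carrier by blast

lemma finite_code: "finite C"
  using subset_carrier finite_carrier_vec_f4 by (rule finite_subset)

lemma card_pos: "card C > 0"
  using finite_code zero_mem card_gt_0_iff by blast

text \<open>Off the dual, some codeword \<open>d\<close> has sign -1; translation by
  \<open>d\<close> permutes \<open>C\<close> and negates the sum, so the sum vanishes.\<close>

lemma sum_chi:
  assumes u: "u \<in> carrier_vec n"
  shows "(\<Sum>c\<in>C. chi u c) = (if u \<in> dual_code n C then real (card C) else 0)"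
proof (cases "u \<in> dual_code n C")
  case True
  thus ?thesis by (simp add: dual_code_def)
next
  case False
  then obtain d where d: "d \<in> C" "chi u d = -1"
    using u chi_cases by (auto simp: dual_code_def)
  have "(\<Sum>c\<in>C. chi u c) = (\<Sum>c\<in>C. chi u (d + c))"
    by (rule sum.reindex_bij_witness[of _ "\<lambda>c. d + c" "\<lambda>c. d + c"])
      (use d in \<open>auto simp: f4_vec_add_add_cancel[OF mem_carrier mem_carrier] intro: add_mem\<close>)
  also have "\<dots> = (\<Sum>c\<in>C. - chi u c)"
    by (rule sum.cong) (use d in \<open>auto simp: chi_add[OF mem_carrier mem_carrier]\<close>)
  finally show ?thesis using False by (simp add: sum_negf)
qed

lemmas additive_dual = additive_dual_code[OF subset_carrier]

text \<open>Double count of the sum of \<open>chi u c\<close> over all vectors \<open>u\<close> and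
  all codewords \<open>c\<close>. Summing over \<open>c\<close> first leaves the \<open>u\<close> in
  the dual; summing over \<open>u\<close> first leaves only \<open>c = 0\<close>.\<close>

lemma card_mult_card_dual: "card C * card (dual_code n C) = 4 ^ n"
proof -
  let ?V = "carrier_vec n :: f4 vec set"
  interpret V: additive_code n ?V by (rule additive_code_carrier_vec)
  have "real (card C * card (dual_code n C)) = (\<Sum>u\<in>dual_code n C. real (card C))"
    by simp
  also have "\<dots> = (\<Sum>u\<in>?V. if u \<in> dual_code n C then real (card C) else 0)"
    by (rule sum.mono_neutral_cong_left) (auto simp: dual_code_def)
  also have "\<dots> = (\<Sum>u\<in>?V. \<Sum>c\<in>C. chi u c)"
    by (simp add: sum_chi)
  also have "\<dots> = (\<Sum>c\<in>C. \<Sum>u\<in>?V. chi c u)"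
    by (subst sum.swap) (auto intro!: sum.cong simp: chi_commute[OF _ mem_carrier])
  also have "\<dots> = (\<Sum>c\<in>C. if c = 0\<^sub>v n then real (4 ^ n) else 0)"
    by (rule sum.cong)
      (auto simp: V.sum_chi mem_carrier dual_carrier_vec card_carrier_vec_f4)
  also have "\<dots> = real (4 ^ n)"
    by (simp add: finite_code)
  finally show ?thesis by (simp only: of_nat_eq_iff)
qed

text \<open>Symmetry of the form gives one inclusion, and the product formula for \<open>C\<close>
  and for its dual makes the cardinalities equal.\<close>

lemma dual_dual: "dual_code n (dual_code n C) = C"
proof -
  interpret U: additive_code n "dual_code n C" by (rule additive_dual)
  have "C \<subseteq> dual_code n (dual_code n C)"
  proof
    fix c assume c: "c \<in> C"
    hence "chi c u = 1" if "u \<in> dual_code n C" for u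
      using that chi_commute[OF mem_carrier[OF c] U.mem_carrier[OF that]]
      by (simp add: dual_code_def)
    thus "c \<in> dual_code n (dual_code n C)"
      using c by (simp add: dual_code_def mem_carrier)
  qed
  moreover have "card (dual_code n (dual_code n C)) = card C"
  proof -
    have "card (dual_code n C) * card (dual_code n (dual_code n C)) = card (dual_code n C) * card C"
      using card_mult_card_dual U.card_mult_card_dual by (simp add: mult.commute)
    thus ?thesis using U.card_pos by simp
  qed
  moreover have "finite (dual_code n (dual_code n C))"
    using additive_code.finite_code[OF U.additive_dual] .
  ultimately show ?thesis by (intro card_subset_eq[symmetric]) auto
qed

text \<open>Orthogonality for the dual code, whose own dual is \<open>C\<close>. It writes the
  indicator of \<open>C\<close> as an average of characters, which is the Fourier inversion used
  below.\<close>

lemma sum_dual_chi: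
  assumes x: "x \<in> carrier_vec n"
  shows "(\<Sum>u\<in>dual_code n C. chi u x) = (if x \<in> C then real (card (dual_code n C)) else 0)"
proof -
  interpret U: additive_code n "dual_code n C" by (rule additive_dual)
  have "(\<Sum>u\<in>dual_code n C. chi u x) = (\<Sum>u\<in>dual_code n C. chi x u)"
    by (rule sum.cong) (auto intro: chi_commute[OF U.mem_carrier x])
  thus ?thesis using U.sum_chi[OF x] by (simp add: dual_dual)
qed

end

section \<open>Weight-one vectors\<close>

lemma hamming_weight_add_le:
  fixes x y :: "f4 vec"
  assumes "x \<in> carrier_vec n" "y \<in> carrier_vec n"
  shows "hamming_weight (x + y) \<le> hamming_weight x + hamming_weight y"
proof -
  have "{i. i < n \<and> (x + y) $ i \<noteq> 0} \<subseteq> {i. i < n \<and> x $ i \<noteq> 0} \<union> {i. i < n \<and> y $ i \<noteq> 0}"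
    using assms by auto
  from card_mono[OF _ this] show ?thesis
    using assms by (auto simp: hamming_weight_def intro: order_trans[OF _ card_Un_le])
qed

lemma hamming_weight_eq_0_iff:
  "x \<in> carrier_vec n \<Longrightarrow> hamming_weight x = 0 \<longleftrightarrow> x = (0\<^sub>v n :: f4 vec)"
  unfolding vec_eq_iff by (auto simp: hamming_weight_def)

definition weight_one_vecs :: "nat \<Rightarrow> f4 vec set" where
  "weight_one_vecs n = {s \<in> carrier_vec n. hamming_weight s = 1}"

text \<open>Parametrisation by position and nonzero value; it turns a sum over weight-one vectors
  into a sum over coordinates.\<close>

lemma weight_one_vecs_conv:
  "weight_one_vecs n = case_prod (single_vec n) ` ({..<n} \<times> (UNIV - {0}))"
proof (intro equalityI subsetI)
  fix s assume "s \<in> weight_one_vecs n"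
  hence s: "s \<in> carrier_vec n" "card {i. i < n \<and> s $ i \<noteq> 0} = 1"
    by (auto simp: weight_one_vecs_def hamming_weight_def)
  then obtain i where i: "{i. i < n \<and> s $ i \<noteq> 0} = {i}"
    by (auto simp: card_1_singleton_iff)
  hence "s = single_vec n i (s $ i)"
    using s(1) by (intro eq_vecI) (auto simp: single_vec_def)
  thus "s \<in> case_prod (single_vec n) ` ({..<n} \<times> (UNIV - {0}))"
    using i by (intro image_eqI[of _ _ "(i, s $ i)"]) auto
next
  fix s assume "s \<in> case_prod (single_vec n) ` ({..<n} \<times> (UNIV - {0}))"
  then obtain i a where s: "s = single_vec n i a" and ia: "i < n" "a \<noteq> 0" by auto
  hence "{j. j < n \<and> s $ j \<noteq> 0} = {i}" by (auto simp: single_vec_def split: if_splits)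
  thus "s \<in> weight_one_vecs n"
    using s by (simp add: weight_one_vecs_def hamming_weight_def carrier_vecD[OF single_vec_carrier])
qed

lemma inj_on_single_vec: "inj_on (case_prod (single_vec n)) ({..<n} \<times> (UNIV - {0}))"
proof (rule inj_onI)
  fix p q
  assume *: "case_prod (single_vec n) p = case_prod (single_vec n) q"
    "p \<in> {..<n} \<times> (UNIV - {0})" "q \<in> {..<n} \<times> (UNIV - {0})"
  obtain i a j b where p: "p = (i, a)" and q: "q = (j, b)" by fastforce
  have "single_vec n i a $ i = a" using *(2) p by (simp add: single_vec_def)
  hence "single_vec n j b $ i = a" using *(1) p q by simp
  hence "(if i = j then b else 0) = a" using *(2) p by (simp add: single_vec_def)
  thus "p = q" using *(2) p q by (auto split: if_splits)
qed

text \<open>For nonzero \<open>b\<close> the sign is 1 at \<open>b\<close> and -1 at the two other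
  nonzero elements.\<close>

lemma sum_nonzero_f4_char:
  "(\<Sum>a\<in>UNIV - {0}. f4_char b a) = (if b = 0 then 3 else -1)"
proof -
  have "UNIV - {0 :: f4} = {F4_one, W, W2}"
    by (auto simp: zero_f4_def intro: f4.exhaust)
  thus ?thesis by (cases b) (simp_all add: f4_char_def zero_f4_def)
qed

text \<open>Each zero coordinate of \<open>u\<close> contributes 3 and each nonzero one -1. The sum
  is the eigenvalue attached to \<open>u\<close> in the Cayley graph of the weight-one
  vectors.\<close>

lemma sum_weight_one_chi:
  assumes u: "u \<in> carrier_vec n"
  shows "(\<Sum>s\<in>weight_one_vecs n. chi u s) = 3 * real n - 4 * real (hamming_weight u)"
proof -
  let ?N = "{i \<in> {..<n}. u $ i \<noteq> 0}"
  have "(\<Sum>s\<in>weight_one_vecs n. chi u s) =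
        (\<Sum>(i, a)\<in>{..<n} \<times> (UNIV - {0}). f4_char (u $ i) a)"
    by (simp add: weight_one_vecs_conv sum.reindex[OF inj_on_single_vec])
      (rule sum.cong, auto simp: chi_single_vec)
  also have "\<dots> = (\<Sum>i<n. if u $ i = 0 then 3 else -1)"
    by (simp add: sum.cartesian_product[symmetric] sum_nonzero_f4_char)
  also have "\<dots> = (\<Sum>i<n. 3 - 4 * (if u $ i \<noteq> 0 then 1 else 0))"
    by (rule sum.cong) auto
  also have "\<dots> = 3 * real n - 4 * (\<Sum>i<n. if u $ i \<noteq> 0 then 1 else 0)"
    by (simp add: sum_subtractf sum_distrib_left)
  also have "(\<Sum>i<n. if u $ i \<noteq> 0 then 1 else (0::real)) = real (card ?N)"
    by (subst sum.inter_filter[symmetric]) auto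
  also have "card ?N = hamming_weight u"
    using u by (simp add: hamming_weight_def)
  finally show ?thesis .
qed

section \<open>The coset graph\<close>

context additive_code
begin

abbreviation U :: "f4 vec set" where "U \<equiv> dual_code n C"

abbreviation coset :: "f4 vec \<Rightarrow> f4 vec set" where "coset x \<equiv> (\<lambda>c. x + c) ` C"

lemmas finite_dual = additive_code.finite_code[OF additive_dual]
  and dual_mem_carrier = additive_code.mem_carrier[OF additive_dual]
  and dual_zero_mem [simp] = additive_code.zero_mem[OF additive_dual]
  and dual_add_mem = additive_code.add_mem[OF additive_dual]
  and card_dual_pos = additive_code.card_pos[OF additive_dual]

lemma cosets_eq: "cosets n C = coset ` carrier_vec n"
  by (auto simp: cosets_def)

lemma finite_cosets: "finite (cosets n C)"
  by (simp add: cosets_eq)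

lemma mem_coset_iff:
  assumes x: "x \<in> carrier_vec n"
  shows "y \<in> coset x \<longleftrightarrow> y \<in> carrier_vec n \<and> x + y \<in> C"
proof
  assume "y \<in> coset x"
  thus "y \<in> carrier_vec n \<and> x + y \<in> C"
    using x by (auto simp: f4_vec_add_add_cancel[OF x mem_carrier] mem_carrier)
next
  assume y: "y \<in> carrier_vec n \<and> x + y \<in> C"
  thus "y \<in> coset x"
    using f4_vec_add_add_cancel[OF x, of y] by (intro image_eqI[of _ _ "x + y"]) auto
qed

lemma coset_self: "x \<in> carrier_vec n \<Longrightarrow> x \<in> coset x"
  by (simp add: mem_coset_iff f4_vec_add_self)

lemma chi_of_dual_coset:
  assumes "u \<in> U" "x \<in> carrier_vec n" "y \<in> coset x"
  shows "chi u y = chi u x"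
  using assms by (auto simp: dual_code_def chi_add[OF _ mem_carrier])

lemma coset_eq_iff:
  assumes x: "x \<in> carrier_vec n" and y: "y \<in> carrier_vec n"
  shows "coset x = coset y \<longleftrightarrow> x + y \<in> C"
proof
  assume "coset x = coset y"
  hence "y \<in> coset x" using coset_self[OF y] by simp
  thus "x + y \<in> C" using mem_coset_iff[OF x] by simp
next
  have *: "coset a \<subseteq> coset b" if "a \<in> carrier_vec n" "b \<in> carrier_vec n" "a + b \<in> C" for a b
  proof
    fix z assume "z \<in> coset a"
    hence z: "z \<in> carrier_vec n" "a + z \<in> C" using mem_coset_iff[OF that(1)] by auto
    have "(a + b) + (a + z) = b + z"
      using that z by (intro f4_vec_add_add_add_cancel) auto
    thus "z \<in> coset b" using mem_coset_iff[OF that(2)] z add_mem[OF that(3) z(2)] by simp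
  qed
  assume "x + y \<in> C"
  thus "coset x = coset y"
    using *[OF x y] *[OF y x] x y by (simp add: comm_add_vec[OF x y])
qed

section \<open>Characters of the quotient by the code\<close>

definition coset_chi :: "f4 vec \<Rightarrow> f4 vec set \<Rightarrow> real" where
  "coset_chi u X = chi u (SOME x. x \<in> X)"

text \<open>The chosen representative is immaterial for \<open>u\<close> in the dual, because
  \<open>chi u\<close> is trivial on \<open>C\<close>.\<close>

lemma coset_chi_coset:
  assumes "u \<in> U" "x \<in> carrier_vec n"
  shows "coset_chi u (coset x) = chi u x"
proof -
  have "(SOME y. y \<in> coset x) \<in> coset x"
    using coset_self[OF assms(2)] by (rule someI)
  thus ?thesis
    using chi_of_dual_coset[OF assms] by (simp add: coset_chi_def)
qed

text \<open>Column orthogonality of the character table: the product of the two values is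
  \<open>chi u (x + y)\<close>, and \<open>x + y\<close> lies in \<open>C\<close> exactly when the
  cosets agree.\<close>

lemma sum_dual_coset_chi:
  assumes "X \<in> cosets n C" "Y \<in> cosets n C"
  shows "(\<Sum>u\<in>U. coset_chi u X * coset_chi u Y) = (if X = Y then real (card U) else 0)"
proof -
  obtain x y where x: "X = coset x" "x \<in> carrier_vec n" and y: "Y = coset y" "y \<in> carrier_vec n"
    using assms by (auto simp: cosets_eq)
  have "(\<Sum>u\<in>U. coset_chi u X * coset_chi u Y) = (\<Sum>u\<in>U. chi u (x + y))"
    by (rule sum.cong) (auto simp: x y coset_chi_coset chi_add[OF x(2) y(2)])
  also have "\<dots> = (if x + y \<in> C then real (card U) else 0)"
    using x y by (intro sum_dual_chi) auto
  finally show ?thesis using x y by (simp add: coset_eq_iff)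
qed

lemma coset_chi_zero: "X \<in> cosets n C \<Longrightarrow> coset_chi (0\<^sub>v n) X = 1"
  by (auto simp: cosets_eq coset_chi_coset)

lemma code_mem_cosets: "C \<in> cosets n C"
proof -
  have "coset (0\<^sub>v n) = C" by (auto simp: image_iff mem_carrier)
  thus ?thesis unfolding cosets_eq by (metis imageI zero_carrier_vec)
qed

text \<open>Translation by a vector \<open>a\<close> with \<open>chi u a = -1\<close> permutes the
  cosets and negates the sum.\<close>

lemma sum_coset_chi:
  assumes u: "u \<in> U" "u \<noteq> 0\<^sub>v n"
  shows "(\<Sum>X\<in>cosets n C. coset_chi u X) = 0"
proof -
  obtain a where a: "a \<in> carrier_vec n" "chi u a = -1"
    using ex_chi_neq_1[OF dual_mem_carrier[OF u(1)] u(2)] chi_cases by blast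
  let ?T = "(`) (\<lambda>x. a + x)"
  have T: "?T (coset x) = coset (a + x)" if "x \<in> carrier_vec n" for x
    using a that by (auto simp: image_image assoc_add_vec[OF _ _ mem_carrier])
  have TT: "?T X \<in> cosets n C" "?T (?T X) = X" "coset_chi u (?T X) = - coset_chi u X"
    if X: "X \<in> cosets n C" for X
  proof -
    obtain x where x: "X = coset x" "x \<in> carrier_vec n" using X by (auto simp: cosets_eq)
    show "?T X \<in> cosets n C" using x a T by (simp add: cosets_eq)
    show "?T (?T X) = X" using x a T f4_vec_add_add_cancel[OF a(1) x(2)] by simp
    show "coset_chi u (?T X) = - coset_chi u X"
      using x a T u by (simp add: coset_chi_coset chi_add[OF a(1) x(2)])
  qed
  have "(\<Sum>X\<in>cosets n C. coset_chi u X) = (\<Sum>X\<in>cosets n C. coset_chi u (?T X))"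
    by (rule sum.reindex_bij_witness[of _ ?T ?T]) (use TT in auto)
  also have "\<dots> = - (\<Sum>X\<in>cosets n C. coset_chi u X)"
    by (simp add: TT(3) sum_negf)
  finally show ?thesis by simp
qed

text \<open>Double count of the whole character table: only the row of the zero word survives in one
  order, only the column of \<open>C\<close> in the other.\<close>

lemma card_cosets: "card (cosets n C) = card U"
proof -
  have "real (card (cosets n C)) =
        (\<Sum>u\<in>U. if u = 0\<^sub>v n then real (card (cosets n C)) else 0)"
    by (simp add: finite_dual)
  also have "\<dots> = (\<Sum>u\<in>U. \<Sum>X\<in>cosets n C. coset_chi u X)"
    by (rule sum.cong) (auto simp: sum_coset_chi coset_chi_zero)
  \<comment> \<open>The inserted factor is 1; it brings the inner sum into the form of column
    orthogonality.\<close>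
  also have "\<dots> = (\<Sum>X\<in>cosets n C. \<Sum>u\<in>U. coset_chi u X * coset_chi u C)"
  proof (subst sum.swap, intro sum.cong refl)
    fix X u assume "u \<in> U"
    have "coset (0\<^sub>v n) = C" by (auto simp: image_iff mem_carrier)
    hence "coset_chi u C = 1" using coset_chi_coset[OF \<open>u \<in> U\<close>, of "0\<^sub>v n"] by simp
    thus "coset_chi u X = coset_chi u X * coset_chi u C" by simp
  qed
  also have "\<dots> = (\<Sum>X\<in>cosets n C. if X = C then real (card U) else 0)"
    by (rule sum.cong) (auto simp: sum_dual_coset_chi code_mem_cosets)
  also have "\<dots> = real (card U)"
    using code_mem_cosets by (simp add: finite_cosets)
  finally show ?thesis by simp
qed

text \<open>Row orthogonality: the product of two characters is the character of
  \<open>u + v\<close>, which is trivial only for \<open>u = v\<close>.\<close>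

lemma sum_coset_chi_mult:
  assumes u: "u \<in> U" and v: "v \<in> U"
  shows "(\<Sum>X\<in>cosets n C. coset_chi u X * coset_chi v X) = (if u = v then real (card U) else 0)"
proof -
  have uv: "u + v \<in> U" using u v by (rule dual_add_mem)
  have "(\<Sum>X\<in>cosets n C. coset_chi u X * coset_chi v X) =
        (\<Sum>X\<in>cosets n C. coset_chi (u + v) X)"
  proof (rule sum.cong)
    fix X assume "X \<in> cosets n C"
    then obtain x where "X = coset x" "x \<in> carrier_vec n" by (auto simp: cosets_eq)
    thus "coset_chi u X * coset_chi v X = coset_chi (u + v) X"
      using u v uv by (simp add: coset_chi_coset chi_add_left[OF dual_mem_carrier dual_mem_carrier])
  qed simp
  also have "\<dots> = (if u + v = 0\<^sub>v n then real (card U) else 0)"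
    using sum_coset_chi[OF uv] by (auto simp: coset_chi_zero card_cosets)
  finally show ?thesis
    using f4_vec_add_eq_zero_iff[OF dual_mem_carrier[OF u] dual_mem_carrier[OF v]] by simp
qed

end

text \<open>Minimum distance at least 3 makes the \<open>3 n\<close> weight-one vectors lie in distinct nontrivial
  cosets, so that the coset graph has neither loops nor multiple edges.\<close>

locale code_dist3 = additive_code +
  assumes min_dist: "c \<in> C \<Longrightarrow> c \<noteq> 0\<^sub>v n \<Longrightarrow> hamming_weight c \<ge> 3"
begin

abbreviation G :: "f4 vec set pair_pre_digraph" where "G \<equiv> coset_graph n C"

definition adj :: "f4 vec set \<Rightarrow> f4 vec set \<Rightarrow> real" where
  "adj X Y = (if (X, Y) \<in> parcs G then 1 else 0)"

definition ev :: "f4 vec \<Rightarrow> real" where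
  "ev u = 3 * real n - 4 * real (hamming_weight u)"

text \<open>The Cayley form of adjacency: the difference of the two cosets is the coset of
  \<open>x + y\<close>, and it must contain a weight-one vector.\<close>

lemma arc_coset_iff:
  assumes x: "x \<in> carrier_vec n" and y: "y \<in> carrier_vec n"
  shows "(coset x, coset y) \<in> parcs G \<longleftrightarrow> (\<exists>s\<in>weight_one_vecs n. x + y + s \<in> C)"
proof -
  have "(coset x, coset y) \<in> parcs G \<longleftrightarrow>
        (\<exists>c\<in>C. \<exists>d\<in>C. hamming_weight ((x + c) + (y + d)) = 1)"
    using x y by (auto simp: coset_graph_def cosets_eq f4_vec_minus_eq_add)
  also have "\<dots> \<longleftrightarrow> (\<exists>s\<in>weight_one_vecs n. x + y + s \<in> C)"
  proof
    assume "\<exists>c\<in>C. \<exists>d\<in>C. hamming_weight ((x + c) + (y + d)) = 1"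
    then obtain c d where cd: "c \<in> C" "d \<in> C" and wt: "hamming_weight ((x + c) + (y + d)) = 1"
      by blast
    have "x + y + ((x + c) + (y + d)) = (x + x) + (y + y) + (c + d)"
      using x y mem_carrier[OF cd(1)] mem_carrier[OF cd(2)]
      by (intro eq_vecI) (auto simp: ac_simps simp del: f4_add_self)
    also have "\<dots> = c + d"
      using x y cd by (simp add: f4_vec_add_self mem_carrier)
    also have "\<dots> \<in> C" using cd by (rule add_mem)
    finally show "\<exists>s\<in>weight_one_vecs n. x + y + s \<in> C"
      using wt x y cd
      by (intro bexI[of _ "(x + c) + (y + d)"]) (auto simp: weight_one_vecs_def mem_carrier)
  next
    assume "\<exists>s\<in>weight_one_vecs n. x + y + s \<in> C"
    then obtain s where s: "s \<in> carrier_vec n" "hamming_weight s = 1" "x + y + s \<in> C"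
      by (auto simp: weight_one_vecs_def)
    \<comment> \<open>The witnesses are the codewords \<open>x + y + s\<close> and zero, whose
      representatives differ by \<open>s\<close>.\<close>
    have "(x + (x + y + s)) + (y + 0\<^sub>v n) = (x + x) + (y + y) + s"
      using x y s by (intro eq_vecI) (auto simp: ac_simps simp del: f4_add_self)
    also have "\<dots> = s"
      using x y s by (simp add: f4_vec_add_self)
    finally have "hamming_weight ((x + (x + y + s)) + (y + 0\<^sub>v n)) = 1"
      using s by simp
    thus "\<exists>c\<in>C. \<exists>d\<in>C. hamming_weight ((x + c) + (y + d)) = 1"
      using s(3) zero_mem by blast
  qed
  finally show ?thesis .
qed

text \<open>Two different choices would add up to a nonzero codeword of weight at most 2.\<close>

lemma weight_one_unique:
  assumes z: "z \<in> carrier_vec n"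
    and s: "s \<in> weight_one_vecs n" "z + s \<in> C" and t: "t \<in> weight_one_vecs n" "z + t \<in> C"
  shows "s = t"
proof (rule ccontr)
  assume "s \<noteq> t"
  have sc: "s \<in> carrier_vec n" "t \<in> carrier_vec n"
    using s t by (auto simp: weight_one_vecs_def)
  have "s + t \<in> C"
    using add_mem[OF s(2) t(2)] f4_vec_add_add_add_cancel[OF z sc] by simp
  moreover have "s + t \<noteq> 0\<^sub>v n" using \<open>s \<noteq> t\<close> f4_vec_add_eq_zero_iff[OF sc] by simp
  ultimately have "hamming_weight (s + t) \<ge> 3" by (rule min_dist)
  thus False
    using hamming_weight_add_le[OF sc] s t by (simp add: weight_one_vecs_def)
qed

lemma finite_weight_one_vecs: "finite (weight_one_vecs n)"
  by (simp add: weight_one_vecs_def)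

text \<open>Spectral decomposition of the adjacency matrix. By uniqueness, \<open>adj X Y\<close>
  counts the weight-one \<open>s\<close> with \<open>x + y + s\<close> in \<open>C\<close>; each
  indicator is expanded into characters, and the sum over \<open>s\<close> yields
  \<open>ev u\<close>.\<close>

lemma adj_expansion:
  assumes X: "X \<in> cosets n C" and Y: "Y \<in> cosets n C"
  shows "real (card U) * adj X Y = (\<Sum>u\<in>U. ev u * coset_chi u X * coset_chi u Y)"
proof -
  obtain x y where x: "X = coset x" "x \<in> carrier_vec n" and y: "Y = coset y" "y \<in> carrier_vec n"
    using assms by (auto simp: cosets_eq)
  let ?T = "{s \<in> weight_one_vecs n. x + y + s \<in> C}"
  have wc: "s \<in> carrier_vec n" if "s \<in> weight_one_vecs n" for s
    using that by (simp add: weight_one_vecs_def)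
  have xy: "x + y \<in> carrier_vec n" using x y by simp
  have "adj X Y = real (card ?T)"
  proof (cases "?T = {}")
    case True
    hence "adj X Y = 0" using arc_coset_iff[OF x(2) y(2)] by (auto simp: adj_def x y)
    thus ?thesis by (subst True) simp
  next
    case False
    then obtain s where s: "s \<in> ?T" by blast
    hence "?T = {s}" using weight_one_unique[OF xy] by auto
    moreover have "adj X Y = 1" using s arc_coset_iff[OF x(2) y(2)] by (auto simp: adj_def x y)
    ultimately show ?thesis by simp
  qed
  hence "real (card U) * adj X Y =
         (\<Sum>s\<in>weight_one_vecs n. if x + y + s \<in> C then real (card U) else 0)"
    by (simp add: sum.inter_filter[OF finite_weight_one_vecs, symmetric])
  also have "\<dots> = (\<Sum>s\<in>weight_one_vecs n. \<Sum>u\<in>U. chi u (x + y + s))"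
    using xy wc by (intro sum.cong) (auto simp: sum_dual_chi)
  also have "\<dots> = (\<Sum>s\<in>weight_one_vecs n. \<Sum>u\<in>U. chi u x * chi u y * chi u s)"
    by (intro sum.cong refl) (simp add: chi_add[OF xy wc] chi_add[OF x(2) y(2)])
  also have "\<dots> = (\<Sum>u\<in>U. chi u x * chi u y * (\<Sum>s\<in>weight_one_vecs n. chi u s))"
    by (subst sum.swap) (simp add: sum_distrib_left)
  also have "\<dots> = (\<Sum>u\<in>U. ev u * coset_chi u X * coset_chi u Y)"
    using x y
    by (intro sum.cong) (auto simp: sum_weight_one_chi[OF dual_mem_carrier] ev_def coset_chi_coset)
  finally show ?thesis .
qed

text \<open>A loop would put a weight-one vector into \<open>C\<close>.\<close>

lemma adj_self: "X \<in> cosets n C \<Longrightarrow> adj X X = 0"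
proof -
  assume "X \<in> cosets n C"
  then obtain x where x: "X = coset x" "x \<in> carrier_vec n" by (auto simp: cosets_eq)
  have False if "s \<in> weight_one_vecs n" "x + x + s \<in> C" for s
  proof -
    have s: "s \<in> carrier_vec n" "hamming_weight s = 1" using that by (auto simp: weight_one_vecs_def)
    hence "s \<in> C" using that(2) x(2) by (simp add: f4_vec_add_self)
    moreover have "s \<noteq> 0\<^sub>v n" using s hamming_weight_eq_0_iff[OF s(1)] by simp
    ultimately show False using min_dist[of s] s by simp
  qed
  thus ?thesis using arc_coset_iff[OF x(2) x(2)] by (auto simp: adj_def x)
qed

text \<open>The trace-zero condition, read off from the expansion of the diagonal entry at
  \<open>C\<close>, where squares of signs are 1.\<close>

lemma sum_ev: "(\<Sum>u\<in>U. ev u) = 0"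
proof -
  have "(\<Sum>u\<in>U. ev u) = (\<Sum>u\<in>U. ev u * coset_chi u C * coset_chi u C)"
    using chi_square by (intro sum.cong refl) (simp add: coset_chi_def mult.assoc)
  also have "\<dots> = real (card U) * adj C C"
    using adj_expansion[OF code_mem_cosets code_mem_cosets] by simp
  finally show ?thesis by (simp add: adj_self code_mem_cosets)
qed

lemma adj_sym: "adj X Y = adj Y X"
proof (cases "X \<in> cosets n C \<and> Y \<in> cosets n C")
  case True
  have "real (card U) * adj X Y = real (card U) * adj Y X"
    using True by (simp only: adj_expansion) (simp add: ac_simps)
  thus ?thesis using card_dual_pos by simp
next
  case False
  thus ?thesis by (auto simp: adj_def coset_graph_def)
qed

text \<open>Entries of the squared adjacency matrix: both factors are expanded, and row
  orthogonality removes the terms with distinct characters.\<close>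

lemma sum_adj_adj:
  assumes X: "X \<in> cosets n C" and Y: "Y \<in> cosets n C"
  shows "real (card U) * (\<Sum>Z\<in>cosets n C. adj X Z * adj Y Z) =
         (\<Sum>u\<in>U. (ev u)\<^sup>2 * coset_chi u X * coset_chi u Y)"
proof -
  let ?M = "real (card U)"
  \<comment> \<open>One factor \<open>?M\<close> goes to each adjacency entry; row orthogonality
    later returns a single \<open>?M\<close> to cancel.\<close>
  have "?M * (?M * (\<Sum>Z\<in>cosets n C. adj X Z * adj Y Z)) =
        (\<Sum>Z\<in>cosets n C. (?M * adj X Z) * (?M * adj Y Z))"
    by (simp add: sum_distrib_left ac_simps)
  also have "\<dots> = (\<Sum>Z\<in>cosets n C. \<Sum>u\<in>U. \<Sum>v\<in>U.
      ev u * coset_chi u X * ev v * coset_chi v Y * (coset_chi u Z * coset_chi v Z))"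
    using X Y
    by (intro sum.cong refl, simp only: adj_expansion sum_product)
      (intro sum.cong refl, simp only: ac_simps)
  also have "\<dots> = (\<Sum>u\<in>U. \<Sum>Z\<in>cosets n C. \<Sum>v\<in>U.
      ev u * coset_chi u X * ev v * coset_chi v Y * (coset_chi u Z * coset_chi v Z))"
    by (rule sum.swap)
  also have "\<dots> = (\<Sum>u\<in>U. \<Sum>v\<in>U. \<Sum>Z\<in>cosets n C.
      ev u * coset_chi u X * ev v * coset_chi v Y * (coset_chi u Z * coset_chi v Z))"
    by (intro sum.cong refl sum.swap)
  also have "\<dots> = (\<Sum>u\<in>U. \<Sum>v\<in>U.
      if u = v then ev u * coset_chi u X * ev v * coset_chi v Y * ?M else 0)"
    by (intro sum.cong refl) (simp add: sum_coset_chi_mult flip: sum_distrib_left)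
  also have "\<dots> = (\<Sum>u\<in>U. ?M * ((ev u)\<^sup>2 * coset_chi u X * coset_chi u Y))"
    by (simp add: finite_dual power2_eq_square ac_simps)
  also have "\<dots> = ?M * (\<Sum>u\<in>U. (ev u)\<^sup>2 * coset_chi u X * coset_chi u Y)"
    by (simp add: sum_distrib_left)
  finally show ?thesis using card_dual_pos by simp
qed

lemma pair_graph_coset_graph: "pair_graph G"
proof
  fix e assume e: "e \<in> parcs G"
  show "fst e \<in> pverts G" "snd e \<in> pverts G"
    using e by (auto simp: coset_graph_def)
  show "fst e \<noteq> snd e"
  proof
    assume eq: "fst e = snd e"
    hence "adj (fst e) (fst e) = 1" using e by (cases e) (simp add: adj_def)
    thus False using adj_self[of "fst e"] e by (auto simp: coset_graph_def)
  qed
next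
  show "finite (pverts G)" by (simp add: coset_graph_def finite_cosets)
  have "parcs G \<subseteq> cosets n C \<times> cosets n C" by (auto simp: coset_graph_def)
  thus "finite (parcs G)" by (rule finite_subset) (simp add: finite_cosets)
  have "(Y, X) \<in> parcs G" if "(X, Y) \<in> parcs G" for X Y
    using that adj_sym[of X Y] by (auto simp: adj_def split: if_splits)
  thus "symmetric G" by (auto simp: symmetric_def intro: symI)
qed

text \<open>The matrix of characters diagonalises the adjacency matrix.\<close>

lemma char_poly_adjacency_matrix:
  assumes vs: "distinct vs" "set vs = pverts G"
  shows "proots (char_poly (adjacency_matrix G vs)) = image_mset ev (mset_set U)"
proof -
  obtain us where us: "set us = U" "distinct us"
    using finite_distinct_list[OF finite_dual] by blast
  define N where "N = card U"
  let ?M = "real N"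
  have vs': "set vs = cosets n C" using vs by (simp add: coset_graph_def)
  have len: "length us = N" "length vs = N"
    using distinct_card[OF us(2)] distinct_card[OF vs(1)] us vs' card_cosets
    by (auto simp: N_def)
  have M: "?M > 0" using card_dual_pos by (simp add: N_def)
  have vsc: "vs ! i \<in> cosets n C" if "i < N" for i using that len vs' nth_mem by metis
  have usc: "us ! i \<in> U" if "i < N" for i using that len us nth_mem by metis
  have sum_us: "(\<Sum>k<N. f (us ! k)) = (\<Sum>u\<in>U. f u)" for f :: "f4 vec \<Rightarrow> real"
    using bij_betw_nth[OF us(2) refl refl] us(1) len by (intro sum.reindex_bij_betw) simp
  define A where "A = adjacency_matrix G vs"
  \<comment> \<open>The character table, scaled by \<open>1 / ?M\<close> so that column
    orthogonality makes it the inverse of \<open>Q\<close>.\<close>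
  define P where "P = mat N N (\<lambda>(i, k). coset_chi (us ! k) (vs ! i) / ?M)"
  define Q where "Q = mat N N (\<lambda>(k, j). coset_chi (us ! k) (vs ! j))"
  define L where "L = mat N N (\<lambda>(i, j). if i = j then ev (us ! i) else 0)"
  have carr: "A \<in> carrier_mat N N" "P \<in> carrier_mat N N" "Q \<in> carrier_mat N N" "L \<in> carrier_mat N N"
    by (auto simp: A_def adjacency_matrix_def P_def Q_def L_def len)
  have PQ: "P * Q = 1\<^sub>m N"
  proof (rule eq_matI)
    fix i j assume "i < dim_row (1\<^sub>m N :: real mat)" "j < dim_col (1\<^sub>m N :: real mat)"
    hence ij: "i < N" "j < N" by auto
    have "(P * Q) $$ (i, j) = (\<Sum>k<N. coset_chi (us ! k) (vs ! i) / ?M * coset_chi (us ! k) (vs ! j))"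
      using ij by (auto simp: P_def Q_def scalar_prod_def atLeast0LessThan)
    also have "\<dots> = (\<Sum>u\<in>U. coset_chi u (vs ! i) * coset_chi u (vs ! j)) / ?M"
      by (subst sum_us) (simp add: sum_divide_distrib)
    also have "\<dots> = (if i = j then 1 else 0)"
      using ij M vs(1) len by (simp add: sum_dual_coset_chi vsc nth_eq_iff_index_eq N_def)
    finally show "(P * Q) $$ (i, j) = 1\<^sub>m N $$ (i, j)" using ij by simp
  qed (auto simp: P_def Q_def)
  have QP: "Q * P = 1\<^sub>m N"
    using carr(2,3) PQ by (rule mat_mult_left_right_inverse)
  have APLQ: "A = P * L * Q"
  proof (rule eq_matI)
    fix i j assume "i < dim_row (P * L * Q)" "j < dim_col (P * L * Q)"
    hence ij: "i < N" "j < N" by (auto simp: P_def Q_def)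
    have PL: "(P * L) $$ (i, k) = ev (us ! k) * coset_chi (us ! k) (vs ! i) / ?M" if "k < N" for k
    proof -
      have "(P * L) $$ (i, k) =
            (\<Sum>l<N. coset_chi (us ! l) (vs ! i) / ?M * (if l = k then ev (us ! l) else 0))"
        using ij that by (auto simp: P_def L_def scalar_prod_def atLeast0LessThan)
      also have "\<dots> = (\<Sum>l<N. if l = k then ev (us ! k) * coset_chi (us ! k) (vs ! i) / ?M else 0)"
        by (rule sum.cong) auto
      finally show ?thesis using that by simp
    qed
    have "(P * L * Q) $$ (i, j) = (\<Sum>k<N. (P * L) $$ (i, k) * coset_chi (us ! k) (vs ! j))"
      using ij by (auto simp: P_def L_def Q_def scalar_prod_def atLeast0LessThan)
    also have "\<dots> = (\<Sum>k<N. ev (us ! k) * coset_chi (us ! k) (vs ! i) * coset_chi (us ! k) (vs ! j) / ?M)"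
      using PL by (intro sum.cong) auto
    also have "\<dots> = (\<Sum>u\<in>U. ev u * coset_chi u (vs ! i) * coset_chi u (vs ! j)) / ?M"
      by (subst sum_us) (simp add: sum_divide_distrib)
    also have "\<dots> = adj (vs ! i) (vs ! j)"
      using adj_expansion[OF vsc[OF ij(1)] vsc[OF ij(2)]] M by (simp add: N_def field_simps)
    also have "\<dots> = A $$ (i, j)"
      using ij len by (simp add: A_def adjacency_matrix_def adj_def)
    finally show "A $$ (i, j) = (P * L * Q) $$ (i, j)" by simp
  qed (use carr in auto)
  have "char_poly A = char_poly L"
    using carr PQ QP APLQ by (intro char_poly_similar similar_matI[of _ _ P Q N]) auto
  also have "\<dots> = (\<Prod>a\<leftarrow>diag_mat L. [:- a, 1:])"
    using carr by (intro char_poly_upper_triangular) (auto simp: L_def)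
  also have "diag_mat L = map ev us"
    using len by (intro nth_equalityI) (auto simp: diag_mat_def L_def)
  finally have "char_poly A = (\<Prod>a\<leftarrow>map ev us. [:- a, 1:])" .
  moreover have "proots (\<Prod>a\<leftarrow>as. [:- a, 1:]) = mset as" for as :: "real list"
  proof (induction as)
    case (Cons a as)
    have "(\<Prod>a\<leftarrow>as. [:- a, 1:]) \<noteq> 0" by (auto simp: prod_list_zero_iff)
    hence "proots ([:- a, 1:] * (\<Prod>a\<leftarrow>as. [:- a, 1:])) = {#a#} + mset as"
      by (subst proots_mult) (auto simp: Cons.IH)
    thus ?case by simp
  qed simp
  ultimately have "proots (char_poly A) = mset (map ev us)" by metis
  also have "\<dots> = image_mset ev (mset_set U)"
    using us mset_set_set[OF us(2)] by simp
  finally show ?thesis by (simp add: A_def)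
qed

end

section \<open>Strong regularity and spectrum from the dual weights\<close>

locale dual_weights_6_8 = code_dist3 9 C for C +
  assumes card_dual: "card (dual_code 9 C) = 64"
    and dual_weights: "u \<in> dual_code 9 C \<Longrightarrow> hamming_weight u \<in> {0, 6, 8}"
begin

lemma ev_zero: "ev (0\<^sub>v 9) = 27"
  using hamming_weight_eq_0_iff[of "0\<^sub>v 9" 9] by (simp add: ev_def)

lemma ev_nonzero: "u \<in> U \<Longrightarrow> u \<noteq> 0\<^sub>v 9 \<Longrightarrow> ev u = 3 \<or> ev u = -5"
  using dual_weights[of u] hamming_weight_eq_0_iff[OF dual_mem_carrier[of u]] by (auto simp: ev_def)

text \<open>Entrywise form of \<open>A^2 = 15 I - 2 A + 12 J\<close>, where 3 and -5 are the roots
  of \<open>t^2 = 15 - 2 t\<close>.\<close>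

lemma sum_adj_adj_eq:
  assumes X: "X \<in> cosets 9 C" and Y: "Y \<in> cosets 9 C"
  shows "(\<Sum>Z\<in>cosets 9 C. adj X Z * adj Y Z) = (if X = Y then 15 else 0) - 2 * adj X Y + 12"
proof -
  have "64 * (\<Sum>Z\<in>cosets 9 C. adj X Z * adj Y Z) =
        (\<Sum>u\<in>U. (ev u)\<^sup>2 * coset_chi u X * coset_chi u Y)"
    using sum_adj_adj[OF X Y] by (simp add: card_dual)
  \<comment> \<open>The eigenvalue 27 of the zero word misses the quadratic by
    \<open>27^2 + 2 * 27 - 15 = 768 = 64 * 12\<close>.\<close>
  also have "\<dots> = (\<Sum>u\<in>U. 15 * (coset_chi u X * coset_chi u Y)
      - 2 * (ev u * coset_chi u X * coset_chi u Y) + (if u = 0\<^sub>v 9 then 768 else 0))"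
  proof (rule sum.cong)
    fix u assume u: "u \<in> U"
    show "(ev u)\<^sup>2 * coset_chi u X * coset_chi u Y = 15 * (coset_chi u X * coset_chi u Y)
      - 2 * (ev u * coset_chi u X * coset_chi u Y) + (if u = 0\<^sub>v 9 then 768 else 0)"
      using ev_nonzero[OF u] ev_zero coset_chi_zero[OF X] coset_chi_zero[OF Y]
      by (cases "u = 0\<^sub>v 9") auto
  qed simp
  also have "\<dots> = 15 * (\<Sum>u\<in>U. coset_chi u X * coset_chi u Y)
      - 2 * (\<Sum>u\<in>U. ev u * coset_chi u X * coset_chi u Y) + 768"
    by (simp add: sum.distrib sum_subtractf finite_dual flip: sum_distrib_left)
  also have "\<dots> = 64 * ((if X = Y then 15 else 0) - 2 * adj X Y + 12)"
    by (simp add: sum_dual_coset_chi[OF X Y] card_dual flip: adj_expansion[OF X Y])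
  finally show ?thesis by simp
qed

lemma card_common_neighbours:
  assumes X: "X \<in> cosets 9 C" and Y: "Y \<in> cosets 9 C"
  shows "real (card {Z \<in> cosets 9 C. (X, Z) \<in> parcs G \<and> (Y, Z) \<in> parcs G}) =
         (if X = Y then 15 else 0) - 2 * adj X Y + 12"
proof -
  have "(\<Sum>Z\<in>cosets 9 C. adj X Z * adj Y Z) =
        (\<Sum>Z\<in>cosets 9 C. if (X, Z) \<in> parcs G \<and> (Y, Z) \<in> parcs G then 1 else 0)"
    by (rule sum.cong) (auto simp: adj_def)
  also have "\<dots> = real (card {Z \<in> cosets 9 C. (X, Z) \<in> parcs G \<and> (Y, Z) \<in> parcs G})"
    by (subst sum.inter_filter[symmetric]) (auto simp: finite_cosets)
  finally show ?thesis using sum_adj_adj_eq[OF X Y] by simp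
qed

lemma strongly_regular_coset_graph: "strongly_regular G 64 27 10 12"
proof -
  have verts: "pverts G = cosets 9 C" by (simp add: coset_graph_def)
  \<comment> \<open>On the diagonal the count of common neighbours is the degree,
    \<open>15 + 12\<close>.\<close>
  have "card {Z \<in> cosets 9 C. (X, Z) \<in> parcs G} = 27" if "X \<in> cosets 9 C" for X
    using card_common_neighbours[OF that that] adj_self[OF that] by simp
  moreover have "card {Z \<in> cosets 9 C. (X, Z) \<in> parcs G \<and> (Y, Z) \<in> parcs G} =
        (if (X, Y) \<in> parcs G then 10 else 12)"
    if "X \<in> cosets 9 C" "Y \<in> cosets 9 C" "X \<noteq> Y" for X Y
    using card_common_neighbours[OF that(1,2)] that(3)
    by (auto simp: adj_def split: if_splits)
  ultimately show ?thesis
    unfolding strongly_regular_def verts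
    using pair_graph_coset_graph by (simp add: card_cosets card_dual)
qed

text \<open>The two multiplicities solve a linear system: they add up to 63, and the eigenvalues add
  up to zero.\<close>

lemma has_spectrum_coset_graph:
  "has_spectrum G (replicate_mset 1 27 + replicate_mset 36 3 + replicate_mset 27 (-5))"
proof -
  define A where "A = {u \<in> U. u \<noteq> 0\<^sub>v 9 \<and> ev u = 3}"
  define B where "B = {u \<in> U. u \<noteq> 0\<^sub>v 9 \<and> ev u = -5}"
  have fin: "finite A" "finite B" using finite_dual by (auto simp: A_def B_def)
  have split: "U = insert (0\<^sub>v 9) (A \<union> B)"
    using ev_nonzero dual_zero_mem by (auto simp: A_def B_def)
  have disj: "A \<inter> B = {}" by (auto simp: A_def B_def)
  have zero: "0\<^sub>v 9 \<notin> A \<union> B" by (auto simp: A_def B_def)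
  have ev_A: "ev u = 3" if "u \<in> A" for u using that by (simp add: A_def)
  have ev_B: "ev u = -5" if "u \<in> B" for u using that by (simp add: B_def)
  have "card U = Suc (card A + card B)"
    by (subst split, subst card_insert_disjoint)
      (use fin disj zero in \<open>auto simp: card_Un_disjoint\<close>)
  hence 1: "real (card A) + real (card B) = 63" using card_dual by simp
  have "(\<Sum>u\<in>U. ev u) = ev (0\<^sub>v 9) + ((\<Sum>u\<in>A. ev u) + (\<Sum>u\<in>B. ev u))"
    by (subst split, subst sum.insert)
      (use fin disj zero in \<open>auto simp: sum.union_disjoint\<close>)
  hence 2: "27 + 3 * real (card A) - 5 * real (card B) = 0"
    using sum_ev by (simp add: ev_zero ev_A ev_B)
  have card: "card A = 36" "card B = 27" using 1 2 by linarith+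
  have "image_mset ev (mset_set U) =
        {#ev (0\<^sub>v 9)#} + (image_mset ev (mset_set A) + image_mset ev (mset_set B))"
    by (subst split, subst mset_set.insert)
      (use fin disj zero in \<open>auto simp: mset_set_Union\<close>)
  also have "image_mset ev (mset_set A) = image_mset (\<lambda>_. 3) (mset_set A)"
    using fin by (intro image_mset_cong) (simp add: ev_A ev_B)
  also have "image_mset ev (mset_set B) = image_mset (\<lambda>_. -5) (mset_set B)"
    using fin by (intro image_mset_cong) (simp add: ev_A ev_B)
  finally have "image_mset ev (mset_set U) =
      replicate_mset 1 27 + replicate_mset 36 3 + replicate_mset 27 (-5)"
    by (simp add: ev_zero image_mset_const_eq card)
  thus ?thesis
    using char_poly_adjacency_matrix finite_cosets
    by (simp add: has_spectrum_def coset_graph_def)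
qed

end

section \<open>Binary spans\<close>

lemma f2_span_conv:
  assumes "set gs \<subseteq> carrier_vec n"
  shows "f2_span n gs = {vec n (\<lambda>j. \<Sum>i<length gs. a i * gs ! i $ j) | a. range a \<subseteq> {0, 1}}"
proof -
  have gs: "gs ! i \<in> carrier_vec n" if "i < length gs" for i
    using that assms nth_mem by blast
  have "finsum_vec TYPE(f4) n (\<lambda>i. a i \<cdot>\<^sub>v gs ! i) {..<length gs} =
        vec n (\<lambda>j. \<Sum>i<length gs. a i * gs ! i $ j)" for a
  proof (rule eq_vecI)
    have "finsum_vec TYPE(f4) n (\<lambda>i. a i \<cdot>\<^sub>v gs ! i) {..<length gs} \<in> carrier_vec n"
      using gs by (intro finsum_vec_closed) auto
    thus "dim_vec (finsum_vec TYPE(f4) n (\<lambda>i. a i \<cdot>\<^sub>v gs ! i) {..<length gs}) =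
          dim_vec (vec n (\<lambda>j. \<Sum>i<length gs. a i * gs ! i $ j))"
      by simp
  next
    fix j assume "j < dim_vec (vec n (\<lambda>j. \<Sum>i<length gs. a i * gs ! i $ j))"
    hence j: "j < n" by simp
    have "finsum_vec TYPE(f4) n (\<lambda>i. a i \<cdot>\<^sub>v gs ! i) {..<length gs} $ j =
          (\<Sum>i<length gs. (a i \<cdot>\<^sub>v gs ! i) $ j)"
      using gs j by (intro index_finsum_vec) auto
    also have "\<dots> = (\<Sum>i<length gs. a i * gs ! i $ j)"
      using gs j by (intro sum.cong refl index_smult_vec) (auto dest: carrier_vecD)
    finally show "finsum_vec TYPE(f4) n (\<lambda>i. a i \<cdot>\<^sub>v gs ! i) {..<length gs} $ j =
          vec n (\<lambda>j. \<Sum>i<length gs. a i * gs ! i $ j) $ j"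
      using j by simp
  qed
  thus ?thesis by (simp add: f2_span_def)
qed

lemma f2_span_Nil: "f2_span n [] = {0\<^sub>v n}"
  by (auto simp: f2_span_conv zero_vec_def intro: exI[of _ "\<lambda>_. 0"])

text \<open>Splits by the coefficient of \<open>g\<close>, which is 0 or 1; this recursion drives
  the inductions over generators.\<close>

lemma f2_span_Cons:
  assumes g: "g \<in> carrier_vec n" and gs: "set gs \<subseteq> carrier_vec n"
  shows "f2_span n (g # gs) = f2_span n gs \<union> (\<lambda>x. g + x) ` f2_span n gs"
proof -
  define w where "w a = vec n (\<lambda>j. \<Sum>i<length gs. a i * gs ! i $ j)" for a :: "nat \<Rightarrow> f4"
  define w' where "w' a = vec n (\<lambda>j. \<Sum>i<length (g # gs). a i * (g # gs) ! i $ j)" for a :: "nat \<Rightarrow> f4"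
  have w': "w' a = a 0 \<cdot>\<^sub>v g + w (\<lambda>i. a (Suc i))" for a
    using g by (intro eq_vecI) (auto simp: w_def w'_def sum.lessThan_Suc_shift simp del: sum.lessThan_Suc)
  have 0: "0 \<cdot>\<^sub>v g + w a = w a" and 1: "1 \<cdot>\<^sub>v g + w a = g + w a" for a
    using g by (auto intro!: eq_vecI simp: w_def)
  have "{w' a | a. range a \<subseteq> {0, 1}} =
        {w a | a. range a \<subseteq> {0, 1}} \<union> (\<lambda>x. g + x) ` {w a | a. range a \<subseteq> {0, 1}}" (is "?L = ?R")
  proof (intro equalityI subsetI)
    fix x assume "x \<in> ?L"
    then obtain a where a: "x = w' a" "range a \<subseteq> {0, 1}" by blast
    have "range (\<lambda>i. a (Suc i)) \<subseteq> {0, 1}" using a(2) by auto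
    moreover have "a 0 = 0 \<or> a 0 = 1" using a(2) by auto
    ultimately show "x \<in> ?R" using a(1) by (auto simp: w' 0 1)
  next
    fix x assume "x \<in> ?R"
    then obtain a c where a: "range a \<subseteq> {0, 1}" and c: "c \<in> {0, 1}" "x = c \<cdot>\<^sub>v g + w a"
      using 0 1 by fastforce
    \<comment> \<open>\<open>case_nat c a\<close> puts the coefficient \<open>c\<close> of
      \<open>g\<close> in front of the family \<open>a\<close>.\<close>
    hence "x = w' (case_nat c a)" by (simp add: w')
    moreover have "range (case_nat c a) \<subseteq> {0, 1}" using a c(1) by (force split: nat.splits)
    ultimately show "x \<in> ?L" by blast
  qed
  thus ?thesis
    using g gs by (simp add: f2_span_conv w_def w'_def del: sum.lessThan_Suc)
qed

lemma additive_f2_span: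
  assumes gs: "set gs \<subseteq> carrier_vec n"
  shows "additive_code n (f2_span n gs)"
  using gs
proof (induction gs)
  case Nil
  show ?case by unfold_locales (auto simp: f2_span_Nil)
next
  case (Cons g gs)
  interpret S: additive_code n "f2_span n gs" using Cons by simp
  have g: "g \<in> carrier_vec n" using Cons.prems by simp
  have eq: "f2_span n (g # gs) = f2_span n gs \<union> (\<lambda>x. g + x) ` f2_span n gs"
    using Cons.prems by (intro f2_span_Cons) auto
  show ?case
  proof
    fix x y assume "x \<in> f2_span n (g # gs)" "y \<in> f2_span n (g # gs)"
    then consider "x \<in> f2_span n gs" "y \<in> f2_span n gs"
      | y' where "x \<in> f2_span n gs" "y' \<in> f2_span n gs" "y = g + y'"
      | x' where "x' \<in> f2_span n gs" "y \<in> f2_span n gs" "x = g + x'"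
      | x' y' where "x' \<in> f2_span n gs" "y' \<in> f2_span n gs" "x = g + x'" "y = g + y'"
      unfolding eq by blast
    thus "x + y \<in> f2_span n (g # gs)"
    proof cases
      case 1
      thus ?thesis unfolding eq by (intro UnI1 S.add_mem)
    next
      case 2
      hence "x + y = g + (x + y')"
        using g S.mem_carrier by (intro eq_vecI) (auto simp: ac_simps dest!: S.mem_carrier)
      thus ?thesis using 2 unfolding eq by (auto intro!: imageI S.add_mem)
    next
      case 3
      hence "x + y = g + (x' + y)"
        using g S.mem_carrier by (auto simp: assoc_add_vec)
      thus ?thesis using 3 unfolding eq by (auto intro!: imageI S.add_mem)
    next
      case 4
      hence "x + y = x' + y'"
        using f4_vec_add_add_add_cancel[OF g S.mem_carrier S.mem_carrier] by simp
      thus ?thesis using 4 unfolding eq by (auto intro: S.add_mem)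
    qed
  qed (use g S.mem_carrier in \<open>auto simp: eq\<close>)
qed

lemma f2_span_subset:
  assumes "additive_code n S" "set gs \<subseteq> S"
  shows "f2_span n gs \<subseteq> S"
  using assms(2)
proof (induction gs)
  case Nil
  show ?case using additive_code.zero_mem[OF assms(1)] by (simp add: f2_span_Nil)
next
  case (Cons g gs)
  have "set (g # gs) \<subseteq> carrier_vec n"
    using Cons.prems additive_code.subset_carrier[OF assms(1)] by blast
  thus ?case
    using Cons additive_code.add_mem[OF assms(1)] by (auto simp: f2_span_Cons)
qed

text \<open>Duals are additive codes, so orthogonality passes from generators to the span, in one
  argument at a time.\<close>

lemma f2_span_self_orthogonal:
  assumes gs: "set gs \<subseteq> carrier_vec n"
    and orth: "\<And>g h. g \<in> set gs \<Longrightarrow> h \<in> set gs \<Longrightarrow> chi g h = 1"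
  shows "f2_span n gs \<subseteq> dual_code n (f2_span n gs)"
proof -
  have "f2_span n gs \<subseteq> dual_code n (set gs)"
    using gs orth by (intro f2_span_subset additive_dual_code) (auto simp: dual_code_def)
  hence "chi g x = 1" if "g \<in> set gs" "x \<in> f2_span n gs" for g x
    using that gs chi_commute[of g n x] by (simp add: dual_code_def subset_iff)
  hence "set gs \<subseteq> dual_code n (f2_span n gs)"
    using gs by (auto simp: dual_code_def)
  thus ?thesis
    by (rule f2_span_subset[OF
          additive_dual_code[OF additive_code.subset_carrier[OF additive_f2_span[OF gs]]]])
qed

section \<open>Exhaustive checks over a span by evaluation\<close>

fun all_sums :: "(f4 list \<Rightarrow> bool) \<Rightarrow> f4 list \<Rightarrow> f4 list list \<Rightarrow> bool" where
  "all_sums Q v [] = Q v"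
| "all_sums Q v (g # gs) = (all_sums Q v gs \<and> all_sums Q (map2 (+) g v) gs)"

text \<open>Running through sums of nonempty sets of generators, not through the span, lets
  \<open>Q\<close> fail at the zero vector; a successful check then also shows that the generators
  are independent.\<close>

fun all_nonempty_sums :: "(f4 list \<Rightarrow> bool) \<Rightarrow> f4 list list \<Rightarrow> bool" where
  "all_nonempty_sums Q [] = True"
| "all_nonempty_sums Q (g # gs) = (all_nonempty_sums Q gs \<and> all_sums Q g gs)"

lemma vec_of_list_map2_add:
  "length xs = length ys \<Longrightarrow> vec_of_list (map2 (+) xs ys) = vec_of_list xs + vec_of_list ys"
  by (rule eq_vecI) (auto simp: vec_of_list_index)

lemma all_sumsD:
  assumes "all_sums Q v gs" "length v = n" "\<forall>g\<in>set gs. length g = n"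
    and "x \<in> f2_span n (map vec_of_list gs)"
  shows "Q (list_of_vec (vec_of_list v + x))"
  using assms
proof (induction gs arbitrary: v x)
  case Nil
  have "vec_of_list v + 0\<^sub>v n = vec_of_list v"
    using Nil by (intro right_zero_vec carrier_vecI) simp
  thus ?case using Nil by (simp add: f2_span_Nil list_vec)
next
  case (Cons g gs)
  let ?S = "f2_span n (map vec_of_list gs)"
  have g: "vec_of_list g \<in> carrier_vec n" and v: "vec_of_list v \<in> carrier_vec n"
    and gs: "set (map vec_of_list gs) \<subseteq> carrier_vec n"
    using Cons.prems by (auto intro!: carrier_vecI)
  interpret S: additive_code n ?S using gs by (rule additive_f2_span)
  have "x \<in> ?S \<or> (\<exists>y\<in>?S. x = vec_of_list g + y)"
    using Cons.prems(4) f2_span_Cons[OF g gs] by auto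
  thus ?case
  proof (elim disjE bexE)
    assume "x \<in> ?S"
    thus ?thesis using Cons by simp
  next
    fix y assume y: "y \<in> ?S" "x = vec_of_list g + y"
    have "vec_of_list v + x = vec_of_list (map2 (+) g v) + y"
      using vec_of_list_map2_add[of g v] Cons.prems(2,3) y(2)
        comm_add_vec[OF v g] assoc_add_vec[OF v g S.mem_carrier[OF y(1)]]
      by (simp del: vec_of_list_map)
    moreover have "Q (list_of_vec (vec_of_list (map2 (+) g v) + y))"
      using Cons.prems y(1) by (intro Cons.IH) auto
    ultimately show ?thesis by simp
  qed
qed

text \<open>A dependence among the generators would make some nonempty sum zero, where
  \<open>Q\<close> fails. Hence each generator doubles the span.\<close>

lemma all_nonempty_sumsD:
  assumes "all_nonempty_sums Q gs" "\<forall>g\<in>set gs. length g = n" "\<not> Q (list_of_vec (0\<^sub>v n))"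
  shows "\<forall>x \<in> f2_span n (map vec_of_list gs). x = 0\<^sub>v n \<or> Q (list_of_vec x)"
    and "card (f2_span n (map vec_of_list gs)) = 2 ^ length gs"
proof -
  have "(\<forall>x \<in> f2_span n (map vec_of_list gs). x = 0\<^sub>v n \<or> Q (list_of_vec x)) \<and>
        card (f2_span n (map vec_of_list gs)) = 2 ^ length gs"
    using assms(1,2)
  proof (induction gs)
    case Nil
    show ?case by (simp add: f2_span_Nil)
  next
    case (Cons g gs)
    let ?S = "f2_span n (map vec_of_list gs)"
    have g: "vec_of_list g \<in> carrier_vec n" and gs: "set (map vec_of_list gs) \<subseteq> carrier_vec n"
      using Cons.prems by (auto intro!: carrier_vecI)
    interpret S: additive_code n ?S using gs by (rule additive_f2_span)
    have eq: "f2_span n (map vec_of_list (g # gs)) = ?S \<union> (\<lambda>x. vec_of_list g + x) ` ?S"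
      using f2_span_Cons[OF g gs] by simp
    have Q: "Q (list_of_vec (vec_of_list g + x))" if "x \<in> ?S" for x
      using Cons.prems that by (intro all_sumsD[of Q g gs n]) auto
    have "?S \<inter> (\<lambda>x. vec_of_list g + x) ` ?S = {}"
    proof (rule ccontr)
      assume "?S \<inter> (\<lambda>x. vec_of_list g + x) ` ?S \<noteq> {}"
      then obtain x where x: "x \<in> ?S" "vec_of_list g + x \<in> ?S" by blast
      \<comment> \<open>An overlap of the two halves puts \<open>g\<close> itself into
        \<open>?S\<close>, so that \<open>g + g = 0\<close> would have to satisfy
        \<open>Q\<close>.\<close>
      let ?y = "x + (vec_of_list g + x)"
      have "?y \<in> ?S" using x by (rule S.add_mem)
      moreover have "?y = vec_of_list g"
        using comm_add_vec[OF g S.mem_carrier[OF x(1)]]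
          f4_vec_add_add_cancel[OF S.mem_carrier[OF x(1)] g] by simp
      ultimately show False using Q[of ?y] assms(3) f4_vec_add_self[OF g] by simp
    qed
    moreover have "inj_on (\<lambda>x. vec_of_list g + x) ?S"
      by (rule inj_onI) (metis f4_vec_add_add_cancel[OF g S.mem_carrier])
    ultimately have "card (f2_span n (map vec_of_list (g # gs))) = 2 * card ?S"
      unfolding eq by (simp add: card_Un_disjoint S.finite_code card_image)
    moreover have "x = 0\<^sub>v n \<or> Q (list_of_vec x)"
      if "x \<in> f2_span n (map vec_of_list (g # gs))" for x
      using that Cons Q unfolding eq by auto
    ultimately show ?case using Cons by simp
  qed
  thus "\<forall>x \<in> f2_span n (map vec_of_list gs). x = 0\<^sub>v n \<or> Q (list_of_vec x)"
    and "card (f2_span n (map vec_of_list gs)) = 2 ^ length gs" by auto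
qed

section \<open>The dodecacode\<close>

fun list_weight :: "f4 list \<Rightarrow> nat" where
  "list_weight [] = 0"
| "list_weight (x # xs) = (case x of F4_zero \<Rightarrow> list_weight xs | _ \<Rightarrow> Suc (list_weight xs))"

text \<open>The first column is chosen so that the generators become pairwise orthogonal; without it
  exactly the first two of them are not.\<close>

definition dodecacode_gens :: "f4 list list" where
  "dodecacode_gens =
    [[1,0,0,0,0,0,W2,W2,0,W,1,W],
     [W,0,0,0,0,0,W,0,W,W,W,1],
     [0,1,0,0,0,0,1,0,1,W2,W2,1],
     [0,W,0,0,0,0,0,W,1,W,W,W],
     [0,0,1,0,0,0,0,1,1,1,W2,W2],
     [0,0,W,0,0,0,W2,1,W2,W,W,0],
     [0,0,0,1,0,0,W,W,1,1,0,1],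
     [0,0,0,W,0,0,W,1,W,W2,W2,0],
     [0,0,0,0,1,0,W,W,W,0,1,W],
     [0,0,0,0,W,0,W2,1,1,W2,0,W],
     [0,0,0,0,0,1,W2,W2,W2,1,0,W2],
     [0,0,0,0,0,W,W,1,0,1,W,W]]"


text \<open>Equality of truth values tracks the parity of the number of coordinates with sign
  -1.\<close>

fun list_orthogonal :: "f4 list \<Rightarrow> f4 list \<Rightarrow> bool" where
  "list_orthogonal (x # xs) (y # ys) =
     ((x = F4_zero \<or> y = F4_zero \<or> x = y) = list_orthogonal xs ys)"
| "list_orthogonal _ _ = True"

lemma hamming_weight_vec_of_list: "hamming_weight (vec_of_list xs) = list_weight xs"
proof -
  have "hamming_weight (vec_of_list xs) = length (filter (\<lambda>x. x \<noteq> 0) xs)"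
    by (simp add: hamming_weight_def length_filter_conv_card vec_of_list_index cong: conj_cong)
  also have "\<dots> = list_weight xs"
    by (induction xs) (auto simp: zero_f4_def split: f4.splits)
  finally show ?thesis .
qed

lemma chi_vec_of_list:
  "length xs = length ys \<Longrightarrow>
   chi (vec_of_list xs) (vec_of_list ys) = (if list_orthogonal xs ys then 1 else -1)"
proof (induction xs ys rule: list_induct2)
  case (Cons x xs y ys)
  have "chi (vec_of_list (x # xs)) (vec_of_list (y # ys)) =
        f4_char x y * chi (vec_of_list xs) (vec_of_list ys)"
    by (simp add: chi_def vec_of_list_index prod.lessThan_Suc_shift del: prod.lessThan_Suc)
  thus ?case using Cons by (auto simp: f4_char_def zero_f4_def)
qed (simp add: chi_def)

definition dodecacode :: "f4 vec set" where
  "dodecacode = f2_span 12 (map vec_of_list dodecacode_gens)"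

lemma length_dodecacode_gens: "\<forall>g\<in>set dodecacode_gens. length g = 12"
  by (simp add: dodecacode_gens_def)

lemma dodecacode_gens_carrier: "set (map vec_of_list dodecacode_gens) \<subseteq> carrier_vec 12"
  using length_dodecacode_gens by (auto intro!: carrier_vecI)

text \<open>Evaluation of all 4095 nonempty sums of the 12 generators.\<close>

lemma dodecacode_weights_check:
  "all_nonempty_sums (\<lambda>v. list_weight v \<in> {6, 8, 10, 12}) dodecacode_gens"
  by code_simp

lemma dodecacode_orthogonal_check:
  "\<forall>g\<in>set dodecacode_gens. \<forall>h\<in>set dodecacode_gens. list_orthogonal g h"
  by code_simp

lemma not_weight_zero: "\<not> list_weight (list_of_vec (0\<^sub>v n)) \<in> {6, 8, 10, 12}"
proof -
  have "list_weight (list_of_vec (0\<^sub>v n)) = hamming_weight (0\<^sub>v n :: f4 vec)"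
    by (simp only: vec_list flip: hamming_weight_vec_of_list)
  thus ?thesis using hamming_weight_eq_0_iff[of "0\<^sub>v n" n] by simp
qed

lemma dodecacode_weights:
  assumes "x \<in> dodecacode" "x \<noteq> 0\<^sub>v 12"
  shows "hamming_weight x \<in> {6, 8, 10, 12}"
  using all_nonempty_sumsD(1)[OF dodecacode_weights_check length_dodecacode_gens not_weight_zero]
    assms hamming_weight_vec_of_list[of "list_of_vec x"]
  by (auto simp: dodecacode_def vec_list)

lemma card_dodecacode: "card dodecacode = 4096"
  using all_nonempty_sumsD(2)[OF dodecacode_weights_check length_dodecacode_gens not_weight_zero]
  by (simp add: dodecacode_def dodecacode_gens_def)

interpretation dodecacode: additive_code 12 dodecacode
  unfolding dodecacode_def using dodecacode_gens_carrier by (rule additive_f2_span)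

text \<open>The generators are pairwise orthogonal, and \<open>4 ^ 12 = 4096 * 4096\<close> forces
  the dual to have the same size.\<close>

lemma dodecacode_self_dual: "dual_code 12 dodecacode = dodecacode"
proof -
  have "dodecacode \<subseteq> dual_code 12 dodecacode"
    unfolding dodecacode_def
    using dodecacode_gens_carrier
  proof (rule f2_span_self_orthogonal)
    fix g h assume "g \<in> set (map vec_of_list dodecacode_gens)" "h \<in> set (map vec_of_list dodecacode_gens)"
    thus "chi g h = 1"
      using dodecacode_orthogonal_check length_dodecacode_gens by (auto simp: chi_vec_of_list)
  qed
  moreover have "card (dual_code 12 dodecacode) = 4096"
    using dodecacode.card_mult_card_dual by (simp add: card_dodecacode)
  ultimately show ?thesis
    using card_dodecacode by (metis card_subset_eq dodecacode.finite_dual)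
qed

section \<open>Puncturing\<close>

text \<open>Kept coordinates form a list, so that successive restrictions compose by indexing one
  list with another.\<close>

definition select :: "nat list \<Rightarrow> f4 vec \<Rightarrow> f4 vec" where
  "select K v = vec (length K) (\<lambda>i. v $ (K ! i))"

lemma select_carrier: "select K v \<in> carrier_vec (length K)"
  by (simp add: select_def)

lemma select_zero: "set K \<subseteq> {..<n} \<Longrightarrow> select K (0\<^sub>v n) = 0\<^sub>v (length K)"
  by (rule eq_vecI) (auto simp: select_def subset_iff)

lemma select_add:
  assumes "set K \<subseteq> {..<n}" "x \<in> carrier_vec n" "y \<in> carrier_vec n"
  shows "select K (x + y) = select K x + select K y"
  using assms by (intro eq_vecI) (auto simp: select_def subset_iff)

lemma select_select:
  assumes "set J \<subseteq> {..<length K}"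
  shows "select J (select K v) = select (map ((!) K) J) v"
  using assms by (intro eq_vecI) (auto simp: select_def subset_iff)

lemma select_image_f2_span:
  assumes K: "set K \<subseteq> {..<n}" and gs: "set gs \<subseteq> carrier_vec n"
  shows "select K ` f2_span n gs = f2_span (length K) (map (select K) gs)"
  using gs
proof (induction gs)
  case Nil
  show ?case using K by (simp add: f2_span_Nil select_zero)
next
  case (Cons g gs)
  have g: "g \<in> carrier_vec n" and gs: "set gs \<subseteq> carrier_vec n" using Cons.prems by auto
  have "select K ` f2_span n (g # gs) =
        select K ` f2_span n gs \<union> (\<lambda>x. select K (g + x)) ` f2_span n gs"
    by (simp add: f2_span_Cons[OF g gs] image_Un image_image)
  also have "(\<lambda>x. select K (g + x)) ` f2_span n gs = (\<lambda>x. select K g + x) ` select K ` f2_span n gs"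
    using additive_code.mem_carrier[OF additive_f2_span[OF gs]]
    by (simp add: image_image select_add[OF K g] cong: image_cong)
  also have "select K ` f2_span n gs = f2_span (length K) (map (select K) gs)"
    using gs by (rule Cons.IH)
  finally show ?case
    by (simp add: f2_span_Cons select_carrier image_subset_iff)
qed

lemma nths_conv_filter: "nths xs A = map ((!) xs) (filter (\<lambda>i. i \<in> A) [0..<length xs])"
proof -
  have "zip xs [0..<length xs] = map (\<lambda>i. (xs ! i, i)) [0..<length xs]"
    by (rule nth_equalityI) auto
  thus ?thesis by (simp add: nths_def filter_map comp_def)
qed

lemma puncture_eq_select:
  assumes "v \<in> carrier_vec n"
  shows "puncture P v = select (filter (\<lambda>i. i \<notin> P) [0..<n]) v"
proof -
  have "nths (list_of_vec v) (- P) = map ((!) (list_of_vec v)) (filter (\<lambda>i. i \<notin> P) [0..<n])"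
    using assms by (simp add: nths_conv_filter)
  thus ?thesis
    using assms unfolding puncture_def
    by (intro eq_vecI) (auto simp: select_def vec_of_list_index list_of_vec_index)
qed

text \<open>Deleting the first column of \<open>dodecacode_gens\<close> gives back the generators of
  \<open>D_minus\<close>, and restriction commutes with spans.\<close>

lemma D_minus_eq: "D_minus = select [Suc 0..<12] ` dodecacode"
proof -
  have sel: "select [Suc 0..<12] (vec_of_list (x # xs)) = vec_of_list xs" if "length xs = 11" for x xs
    using that by (intro eq_vecI) (auto simp: select_def vec_of_list_index)
  have "select [Suc 0..<12] ` dodecacode =
        f2_span 11 (map (select [Suc 0..<12]) (map vec_of_list dodecacode_gens))"
    unfolding dodecacode_def by (subst select_image_f2_span[OF _ dodecacode_gens_carrier]) auto
  also have "map (select [Suc 0..<12]) (map vec_of_list dodecacode_gens) =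
             map vec_of_list (map tl dodecacode_gens)"
    by (simp add: dodecacode_gens_def sel del: vec_of_list_Cons)
  also have "f2_span 11 \<dots> = D_minus"
    by (simp add: D_minus_def dodecacode_gens_def)
  finally show ?thesis by simp
qed

text \<open>Coordinate \<open>i\<close> of \<open>D_minus\<close> is coordinate \<open>Suc i\<close>
  of the dodecacode, because of the prefixed column.\<close>

lemma puncture_D_minus:
  "puncture P ` D_minus = select (map Suc (filter (\<lambda>i. i \<notin> P) [0..<11])) ` dodecacode"
proof -
  have "puncture P (select [Suc 0..<12] x) = select (map Suc (filter (\<lambda>i. i \<notin> P) [0..<11])) x" for x
  proof -
    have "puncture P (select [Suc 0..<12] x) =
          select (map ((!) [Suc 0..<12]) (filter (\<lambda>i. i \<notin> P) [0..<11])) x"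
      using select_carrier[of "[Suc 0..<12]" x]
      by (subst puncture_eq_select[of _ 11]) (auto intro!: select_select)
    also have "map ((!) [Suc 0..<12]) (filter (\<lambda>i. i \<notin> P) [0..<11]) = map Suc (filter (\<lambda>i. i \<notin> P) [0..<11])"
      by (rule map_cong) auto
    finally show ?thesis .
  qed
  thus ?thesis by (simp add: D_minus_eq image_image)
qed

text \<open>At most \<open>n - length K\<close> nonzero coordinates of \<open>x\<close> lie outside
  \<open>K\<close>.\<close>

lemma hamming_weight_select_ge:
  assumes K: "distinct K" "set K \<subseteq> {..<n}" and x: "x \<in> carrier_vec n"
  shows "hamming_weight x \<le> hamming_weight (select K x) + (n - length K)"
proof -
  let ?S = "{i. i < length K \<and> x $ (K ! i) \<noteq> 0}"
  have "{i. i < n \<and> x $ i \<noteq> 0} \<subseteq> (!) K ` ?S \<union> ({..<n} - set K)"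
    by (fastforce simp: in_set_conv_nth)
  hence "hamming_weight x \<le> card ((!) K ` ?S \<union> ({..<n} - set K))"
    using x by (auto simp: hamming_weight_def intro!: card_mono)
  also have "\<dots> \<le> card ((!) K ` ?S) + card ({..<n} - set K)"
    by (rule card_Un_le)
  also have "card ((!) K ` ?S) \<le> card ?S"
    by (rule card_image_le) simp
  also have "card ?S = hamming_weight (select K x)"
    by (auto simp: hamming_weight_def select_def intro: arg_cong[where f = card])
  also have "card ({..<n} - set K) = n - length K"
    using K by (simp add: card_Diff_subset distinct_card)
  finally show ?thesis by simp
qed

section \<open>Extension by zero, the adjoint of restriction\<close>

definition extend_zero :: "nat \<Rightarrow> nat list \<Rightarrow> f4 vec \<Rightarrow> f4 vec" where
  "extend_zero n K y = vec n (\<lambda>j. \<Sum>i<length K. if K ! i = j then y $ i else 0)"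

lemma extend_zero_carrier: "extend_zero n K y \<in> carrier_vec n"
  by (simp add: extend_zero_def)

lemma extend_zero_nth:
  assumes "distinct K" "set K \<subseteq> {..<n}" "i < length K"
  shows "extend_zero n K y $ (K ! i) = y $ i"
proof -
  have "extend_zero n K y $ (K ! i) = (\<Sum>k<length K. if K ! k = K ! i then y $ k else 0)"
    using assms by (auto simp: extend_zero_def subset_iff)
  \<comment> \<open>Distinctness of \<open>K\<close> leaves a single term in the defining
    sum.\<close>
  also have "\<dots> = (\<Sum>k<length K. if k = i then y $ k else 0)"
    using assms by (intro sum.cong) (auto simp: nth_eq_iff_index_eq)
  finally show ?thesis using assms by simp
qed

lemma extend_zero_notin: "j < n \<Longrightarrow> j \<notin> set K \<Longrightarrow> extend_zero n K y $ j = 0"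
  by (auto simp: extend_zero_def intro!: sum.neutral)

text \<open>Positions outside \<open>K\<close> contribute the sign 1. Consequently a word is dual to
  a restricted code exactly when its extension by zero is dual to the full code.\<close>

lemma chi_extend_zero:
  assumes K: "distinct K" "set K \<subseteq> {..<n}" and x: "x \<in> carrier_vec n"
  shows "chi (extend_zero n K y) x = chi y (select K x)"
proof -
  let ?e = "extend_zero n K y"
  have "chi ?e x = (\<Prod>j<n. f4_char (?e $ j) (x $ j))"
    using x by (simp add: chi_def)
  also have "\<dots> = (\<Prod>j\<in>set K. f4_char (?e $ j) (x $ j))"
    using K by (intro prod.mono_neutral_right) (auto simp: extend_zero_notin f4_char_def)
  also have "\<dots> = (\<Prod>i<length K. f4_char (?e $ (K ! i)) (x $ (K ! i)))"
    using bij_betw_nth[OF K(1) refl refl]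
    by (rule prod.reindex_bij_betw[symmetric])
  also have "\<dots> = chi y (select K x)"
    using K by (simp add: chi_def select_def extend_zero_nth)
  finally show ?thesis .
qed

lemma hamming_weight_extend_zero:
  assumes K: "distinct K" "set K \<subseteq> {..<n}" and y: "y \<in> carrier_vec (length K)"
  shows "hamming_weight (extend_zero n K y) = hamming_weight y"
proof -
  let ?S = "{i. i < length K \<and> y $ i \<noteq> 0}"
  have "{j. j < n \<and> extend_zero n K y $ j \<noteq> 0} = (!) K ` ?S"
  proof (intro equalityI subsetI)
    fix j assume "j \<in> {j. j < n \<and> extend_zero n K y $ j \<noteq> 0}"
    hence j: "j < n" "extend_zero n K y $ j \<noteq> 0" by auto
    hence "j \<in> set K" using extend_zero_notin by blast
    then obtain i where "i < length K" "j = K ! i" by (auto simp: in_set_conv_nth)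
    thus "j \<in> (!) K ` ?S" using j extend_zero_nth[OF K] by auto
  qed (use K extend_zero_nth[OF K] in \<open>auto simp: subset_iff\<close>)
  moreover have "inj_on ((!) K) ?S"
    using K(1) by (auto simp: inj_on_def nth_eq_iff_index_eq)
  ultimately show ?thesis
    using y by (simp add: hamming_weight_def card_image carrier_vecD[OF extend_zero_carrier])
qed

text \<open>Dropping three coordinates keeps the map injective and the minimum distance at least
  \<open>6 - 3\<close>, so the dual has \<open>4 ^ 9 / 4096 = 64\<close> words. By self-duality
  these extend by zero to words of the dodecacode.\<close>

lemma two_weight_select_dodecacode:
  assumes K: "distinct K" "set K \<subseteq> {..<12}" and len: "length K = 9"
  shows "dual_weights_6_8 (select K ` dodecacode)"
proof -
  let ?C = "select K ` dodecacode"
  note [simp] = dodecacode.mem_carrier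
  have light: "x = 0\<^sub>v 12" if "x \<in> dodecacode" "hamming_weight (select K x) < 3" for x
    using hamming_weight_select_ge[OF K, of x] dodecacode_weights[of x] that len by fastforce
  interpret C: additive_code 9 ?C
  proof
    show "?C \<subseteq> carrier_vec 9" using select_carrier[of K] len by auto
    show "0\<^sub>v 9 \<in> ?C"
      using select_zero[OF K(2)] len by (metis dodecacode.zero_mem image_eqI)
    fix x y assume "x \<in> ?C" "y \<in> ?C"
    then obtain a b where "a \<in> dodecacode" "b \<in> dodecacode" "x = select K a" "y = select K b" by blast
    thus "x + y \<in> ?C"
      by (intro image_eqI[of _ _ "a + b"]) (auto simp: select_add[OF K(2)] dodecacode.add_mem)
  qed
  have "inj_on (select K) dodecacode"
  proof (rule inj_onI)
    fix x y assume xy: "x \<in> dodecacode" "y \<in> dodecacode" "select K x = select K y"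
    have "select K (x + y) = 0\<^sub>v 9"
      using xy f4_vec_add_self[OF select_carrier[of K y]] len by (simp add: select_add[OF K(2)])
    hence "x + y = 0\<^sub>v 12"
      using xy hamming_weight_eq_0_iff[of "0\<^sub>v 9" 9] by (intro light) (auto intro: dodecacode.add_mem)
    thus "x = y" using xy by (simp add: f4_vec_add_eq_zero_iff)
  qed
  hence card: "card ?C = 4096" by (simp add: card_image card_dodecacode)
  show ?thesis
  proof
    fix c assume "c \<in> ?C" "c \<noteq> 0\<^sub>v 9"
    thus "3 \<le> hamming_weight c"
      using light select_zero[OF K(2)] len by (metis imageE not_le)
  next
    show "card (dual_code 9 ?C) = 64" using C.card_mult_card_dual card by simp
  next
    fix u assume u: "u \<in> dual_code 9 ?C"
    hence uc: "u \<in> carrier_vec 9" by (simp add: dual_code_def)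
    let ?e = "extend_zero 12 K u"
    have "?e \<in> dual_code 12 dodecacode"
      using u by (simp add: dual_code_def chi_extend_zero[OF K] extend_zero_carrier)
    hence e: "?e \<in> dodecacode" by (simp add: dodecacode_self_dual)
    have "hamming_weight ?e \<in> {0, 6, 8, 10, 12}"
      using dodecacode_weights[OF e] hamming_weight_eq_0_iff[of ?e 12] e by auto
    moreover have "hamming_weight ?e = hamming_weight u"
      using hamming_weight_extend_zero[OF K, of u] uc len by simp
    \<comment> \<open>Length 9 rules out the weights 10 and 12.\<close>
    moreover have "hamming_weight u \<le> card {..<9 :: nat}"
      unfolding hamming_weight_def using uc by (intro card_mono) auto
    ultimately show "hamming_weight u \<in> {0, 6, 8}" by auto
  qed
qed

theorem theorem12:
  fixes P :: "nat set"
  assumes "P \<subseteq> {..<11}" and "card P = 2"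
  shows "strongly_regular (coset_graph 9 (puncture P ` D_minus)) 64 27 10 12 \<and>
         has_spectrum (coset_graph 9 (puncture P ` D_minus))
           (replicate_mset 1 27 + replicate_mset 36 3 + replicate_mset 27 (-5))"
proof -
  let ?J = "filter (\<lambda>i. i \<notin> P) [0..<11]"
  have "length ?J = card ({..<11} - P)"
    by (subst distinct_card[symmetric]) (auto intro: arg_cong[where f = card])
  also have "\<dots> = 9"
    using assms by (simp add: card_Diff_subset finite_subset[OF assms(1)])
  finally have "dual_weights_6_8 (select (map Suc ?J) ` dodecacode)"
    by (intro two_weight_select_dodecacode) (auto simp: distinct_map)
  then interpret dual_weights_6_8 "puncture P ` D_minus"
    by (simp only: puncture_D_minus)
  show ?thesis
    using strongly_regular_coset_graph has_spectrum_coset_graph by blast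
qed

end
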